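(* For every $d\ge 1$ and every partition $\alpha\vdash d$, the genus zero monotone single Hurwitz number $\vec H_0(\alpha)$ is given by $$\frac{|\mathrm{Aut}\,\alpha|}{d!}\vec H_0(\alpha)=\left(\prod_{i=1}^{\ell(\alpha)}\binom{2\alpha_i}{\alpha_i}\right)(2d+1)^{\overline{\ell(\alpha)-3}}.$$
   Context: For a partition $\alpha$ of $d\ge 1$ with $\ell(\alpha)$ parts and an integer $g\ge 0$, $\vec H_g(\alpha)$ is the number of $(r+1)$-tuples $(\sigma,\tau_1,\dots,\tau_r)$ of permutations in the symmetric group on $\{1,\dots,d\}$, with $r=2g-2+\ell(\alpha)+d$, such that: $\sigma$ has cycle type $\alpha$ and the $\tau_i$ are transpositions; $\sigma\tau_1\cdots\tau_r$ is the identity; the group $\langle\sigma,\tau_1,\dots,\tau_r\rangle$ acts transitively on $\{1,\dots,d\}$; and, writing $\tau_i=(s_i\ t_i)$ with $s_i<t_i$, one has $t_1\le\dots\le t_r$. $|\mathrm{Aut}\,\alpha|=\prod_{k\ge1}m_k!$ where $m_k$ is the number of parts of $\alpha$ equal to $k$. For $k\ge 0$, $(2d+1)^{\overline{k}}=(2d+1)(2d+2)\cdots(2d+k)$ is a rising product with $k$ factors (equal to $1$ for $k=0$), in general $a^{\overline k}=a(a+1)\cdots(a+k-1)$, and for $k<0$ by convention $(2d+1)^{\overline{k}}=\dfrac{1}{(2d+k+1)^{\overline{-k}}}$. *)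

theory Defs
  imports Complex_Main "HOL-Library.Multiset" "HOL-Combinatorics.Orbits" "HOL-Algebra.Sym_Groups"
begin

definition is_partition :: "nat multiset \<Rightarrow> nat \<Rightarrow> bool" where
  "is_partition \<alpha> d \<longleftrightarrow> 0 \<notin># \<alpha> \<and> sum_mset \<alpha> = d"

definition card_Aut :: "nat multiset \<Rightarrow> nat" where
  "card_Aut \<alpha> = (\<Prod>k\<in>set_mset \<alpha>. fact (count \<alpha> k))"

(* Fixed points count as cycles of length 1: for a fixed point x, orbit \<sigma> x = {x}. *)
definition cycle_type :: "nat \<Rightarrow> (nat \<Rightarrow> nat) \<Rightarrow> nat multiset" where
  "cycle_type d \<sigma> = image_mset card (mset_set (orbit \<sigma> ` {1..d}))"

(* Each \<tau>\<^sub>i is the transposition (s\<^sub>i t\<^sub>i) with s\<^sub>i < t\<^sub>i, and t is weakly increasing. The lists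
   s and t are determined by \<tau>s, so it is the permutations \<tau>\<^sub>i that get counted. *)
definition monotone_transpositions :: "nat \<Rightarrow> (nat \<Rightarrow> nat) list \<Rightarrow> bool" where
  "monotone_transpositions d \<tau>s \<longleftrightarrow>
     (\<exists>s t. length s = length \<tau>s \<and> length t = length \<tau>s \<and>
        (\<forall>i<length \<tau>s. s ! i \<in> {1..d} \<and> t ! i \<in> {1..d} \<and> s ! i < t ! i \<and>
           \<tau>s ! i = Transposition.transpose (s ! i) (t ! i)) \<and>
        sorted t)"

definition generates_transitive :: "nat \<Rightarrow> (nat \<Rightarrow> nat) set \<Rightarrow> bool" where
  "generates_transitive d S \<longleftrightarrow>
     (\<forall>x\<in>{1..d}. \<forall>y\<in>{1..d}. \<exists>p\<in>generate (sym_group d) S. p x = y)"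

(* The length of \<tau>s is r = 2g - 2 + l(\<alpha>) + d; for a partition of d \<ge> 1 one has l(\<alpha>) + d \<ge> 2, so
   the subtraction on nat does not truncate. *)
definition monotone_Hurwitz_tuples ::
    "nat \<Rightarrow> nat multiset \<Rightarrow> ((nat \<Rightarrow> nat) \<times> (nat \<Rightarrow> nat) list) set" where
  "monotone_Hurwitz_tuples g \<alpha> =
     (let d = sum_mset \<alpha> in
      {(\<sigma>, \<tau>s). \<sigma> permutes {1..d} \<and> cycle_type d \<sigma> = \<alpha> \<and>
         length \<tau>s = 2 * g + size \<alpha> + d - 2 \<and>
         monotone_transpositions d \<tau>s \<and>
         \<sigma> \<circ> foldr (\<circ>) \<tau>s id = id \<and>
         generates_transitive d (insert \<sigma> (set \<tau>s))})"

definition monotone_Hurwitz :: "nat \<Rightarrow> nat multiset \<Rightarrow> nat" where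
  "monotone_Hurwitz g \<alpha> = card (monotone_Hurwitz_tuples g \<alpha>)"

(* The rising product extended to negative exponents by a^k = 1 / (a + k)^(-k); for a = 2d + 1
   this is the convention (2d + 1)^k = 1 / (2d + k + 1)^(-k). *)
definition rising :: "real \<Rightarrow> int \<Rightarrow> real" where
  "rising a k = (if k \<ge> 0 then pochhammer a (nat k)
                 else 1 / pochhammer (a + of_int k) (nat (- k)))"

end

theory Submission
  imports Defs
begin

text \<open>
  Fix a permutation of a finite set with largest element \<open>m\<close> and count its factorizations into a
  monotone transitive sequence of transpositions. Transitivity forces the last transposition to be
  \<open>(s m)\<close>. Removing it either joins the cycles of \<open>s\<close> and \<open>m\<close>, or cuts the cycle of \<open>m\<close> in two. In
  the second case minimality of the genus makes the remaining transpositions act transitively on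
  two complementary sets separating \<open>s\<close> from \<open>m\<close>; since their larger entries are disjoint, two
  monotone sequences on these sets interleave in exactly one monotone way. This recursion holds
  for each individual permutation, so it is enough to check that the claimed formula, divided by
  the size of the conjugacy class, satisfies it for every choice of the cycle containing \<open>m\<close>. By
  Rothe's convolution identity the check reduces to the partial fraction expansion
  \<open>2 \<Sum>\<^sub>i\<^sub>\<le>\<^sub>n C\<^sub>i C\<^sub>n\<^sub>-\<^sub>i / (i + 1 + x) = C\<^sub>x\<^sub>+\<^sub>n\<^sub>+\<^sub>1 / (C\<^sub>x (2 x + 1))\<close> with \<open>C\<^sub>n\<close> the central binomial
  coefficients.
\<close>

section \<open>Sums of central binomial coefficients and Rothe convolutions\<close>

text \<open>Monotonicity is not invariant under conjugation, so it is not evident that the count for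
  one permutation depends only on its cycle type; the induction proves this along with the formula,
  since the recursion expands at whichever cycle happens to contain the maximum. The obstacle is the
  cut term. It runs over all distributions of the other cycles to the two sides, and rising products
  of exponent (number of cycles) - 3 do not convolve. The remedy is to split off the factor a C_a =
  2 (2a - 1) C_(a-1) of the cycle of length a containing the maximum: C_(a-1) stays outside, and 2
  (2a - 1) times the rising product is a combination of Rothe polynomials, which do convolve. After
  the convolution the length i of one piece survives only in reciprocals weighted by C_(i-1)
  C_(k-i-1), where k is the length of the cycle being cut, and that is a partial fraction
  sum.\<close>

definition central_binomial :: "nat \<Rightarrow> real" where
  "central_binomial n = real ((2 * n) choose n)"

lemma central_binomial_0 [simp]: "central_binomial 0 = 1"
  by (simp add: central_binomial_def)

lemma central_binomial_pos [simp]: "central_binomial n > 0"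
  by (simp add: central_binomial_def)

lemma central_binomial_nonzero [simp]: "central_binomial n \<noteq> 0"
  using central_binomial_pos[of n] by linarith

lemma central_binomial_Suc:
  "(real n + 1) * central_binomial (Suc n) = (4 * real n + 2) * central_binomial n"
proof -
  have "Suc n * ((2 * Suc n) choose Suc n) = (2 * Suc n) * ((2 * n + 1) choose n)"
    using Suc_times_binomial_eq[of "2 * n + 1" n] by simp
  moreover have "Suc n * ((2 * n + 1) choose n) = (2 * n + 1) * ((2 * n) choose n)"
    using binomial_absorb_comp[of "2 * n + 1" n] by simp
  ultimately have "Suc n * (Suc n * ((2 * Suc n) choose Suc n))
      = Suc n * (2 * ((2 * n + 1) * ((2 * n) choose n)))"
    by (metis mult.assoc mult.commute)
  then have "Suc n * ((2 * Suc n) choose Suc n) = 2 * ((2 * n + 1) * ((2 * n) choose n))"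
    by (metis mult_cancel1 nat.distinct(1))
  then have "real (Suc n * ((2 * Suc n) choose Suc n)) = real (2 * ((2 * n + 1) * ((2 * n) choose n)))"
    by (rule arg_cong)
  then show ?thesis
    unfolding central_binomial_def by (simp only: of_nat_mult of_nat_add of_nat_Suc) (simp add: algebra_simps)
qed

lemma central_binomial_pred:
  assumes "k \<ge> 1"
  shows "real k * central_binomial k = 2 * (2 * real k - 1) * central_binomial (k - 1)"
proof -
  obtain n where "k = Suc n" using assms by (cases k) auto
  then show ?thesis using central_binomial_Suc[of n] by (simp add: algebra_simps)
qed

text \<open>Coefficient form of the square of (1 - 4z)^(-1/2). Weighting the summands by
  \<open>i\<close> makes the recurrence \<open>central_binomial_Suc\<close> applicable, and the
  symmetry i <-> n - i shows that the weighted sum is n/2 times the plain one; comparing the two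
  gives a factor 4 per step.\<close>

lemma sum_central_binomial_convolution:
  "(\<Sum>i\<le>n. central_binomial i * central_binomial (n - i)) = 4 ^ n"
proof (induction n)
  case (Suc n)
  let ?c = central_binomial
  let ?S = "\<lambda>n. \<Sum>i\<le>n. ?c i * ?c (n - i)"
  have first_moment: "2 * (\<Sum>i\<le>n. real i * (?c i * ?c (n - i))) = real n * ?S n" for n
  proof -
    have "(\<Sum>i\<le>n. real i * (?c i * ?c (n - i))) = (\<Sum>i\<le>n. real (n - i) * (?c i * ?c (n - i)))"
      by (subst sum.nat_diff_reindex[symmetric, of _ "Suc n", simplified lessThan_Suc_atMost])
        (rule sum.cong, auto simp: mult.commute)
    then have "2 * (\<Sum>i\<le>n. real i * (?c i * ?c (n - i)))
        = (\<Sum>i\<le>n. real i * (?c i * ?c (n - i)) + real (n - i) * (?c i * ?c (n - i)))"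
      by (simp add: sum.distrib)
    also have "\<dots> = (\<Sum>i\<le>n. real n * (?c i * ?c (n - i)))"
      by (rule sum.cong) (auto simp: of_nat_diff algebra_simps)
    finally show ?thesis by (simp add: sum_distrib_left)
  qed
  have "(\<Sum>i\<le>Suc n. real i * (?c i * ?c (Suc n - i))) = (\<Sum>i\<le>n. real (Suc i) * (?c (Suc i) * ?c (n - i)))"
    by (subst sum.atMost_Suc_shift) simp
  also have "\<dots> = (\<Sum>i\<le>n. (4 * real i + 2) * (?c i * ?c (n - i)))"
    by (rule sum.cong) (use central_binomial_Suc in \<open>auto simp: mult.assoc[symmetric] add.commute\<close>)
  also have "\<dots> = 4 * (\<Sum>i\<le>n. real i * (?c i * ?c (n - i))) + 2 * ?S n"
    by (simp add: sum.distrib sum_distrib_left algebra_simps)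
  also have "\<dots> = (2 * real n + 2) * ?S n"
    using first_moment[of n] by (simp add: algebra_simps)
  finally have "real (Suc n) * ?S (Suc n) = real (Suc n) * (4 * ?S n)"
    using first_moment[of "Suc n"] by (simp add: algebra_simps)
  then have "?S (Suc n) = 4 * ?S n"
    by (metis mult_cancel_left of_nat_eq_0_iff nat.distinct(1))
  then show ?case using Suc.IH by simp
qed simp

text \<open>Multiplying the sum for \<open>Suc n\<close> by K = (i + 1 + x) + (n + 1 - i) cancels
  the denominator in one half and lets the recurrence of the central binomials act in the other. The
  result is a first-order recurrence in \<open>n\<close>, which the right-hand side satisfies by
  \<open>central_binomial_Suc\<close>.\<close>

lemma sum_central_binomial_quotient:
  "2 * (\<Sum>i\<le>n. central_binomial i * central_binomial (n - i) / (real i + 1 + real x))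
     = central_binomial (x + n + 1) / (central_binomial x * (2 * real x + 1))"
proof (induction n)
  case 0
  have "(real x + 1) * central_binomial (Suc x) = (4 * real x + 2) * central_binomial x"
    by (rule central_binomial_Suc)
  moreover have "2 / (1 + b) = p / (q * (2 * b + 1))"
    if "(b + 1) * p = (4 * b + 2) * q" "q > 0" "b \<ge> 0" for b p q :: real
    using that by (subst frac_eq_eq) (auto simp: algebra_simps add_nonneg_eq_0_iff)
  ultimately show ?case by simp
next
  case (Suc n)
  let ?c = central_binomial
  let ?f = "\<lambda>n. \<Sum>i\<le>n. ?c i * ?c (n - i) / (real i + 1 + real x)"
  define K where "K = real x + real n + 2"
  have K: "K > 0" by (simp add: K_def)
  have "K * ?f (Suc n) = (\<Sum>i\<le>Suc n. ?c i * ?c (Suc n - i)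
      + ?c i * (real (Suc n - i) * ?c (Suc n - i)) / (real i + 1 + real x))"
    unfolding sum_distrib_left
  proof (rule sum.cong)
    fix i assume i: "i \<in> {..Suc n}"
    define A where "A = real i + 1 + real x"
    have "A > 0" by (simp add: A_def add_nonneg_pos)
    moreover have "K = A + real (Suc n - i)"
      using i by (simp add: A_def K_def of_nat_diff)
    ultimately show "K * (?c i * ?c (Suc n - i) / A) = ?c i * ?c (Suc n - i)
        + ?c i * (real (Suc n - i) * ?c (Suc n - i)) / A"
      by (simp add: add_divide_eq_iff distrib_left distrib_right divide_eq_eq ac_simps)
  qed simp
  also have "\<dots> = 4 ^ Suc n + (\<Sum>i\<le>Suc n. ?c i * (real (Suc n - i) * ?c (Suc n - i)) / (real i + 1 + real x))"
    by (simp only: sum.distrib sum_central_binomial_convolution)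
  also have "(\<Sum>i\<le>Suc n. ?c i * (real (Suc n - i) * ?c (Suc n - i)) / (real i + 1 + real x))
     = (\<Sum>i\<le>n. ?c i * (real (Suc n - i) * ?c (Suc n - i)) / (real i + 1 + real x))"
    by simp
  also have "\<dots> = (\<Sum>i\<le>n. ?c i * ((4 * real (n - i) + 2) * ?c (n - i)) / (real i + 1 + real x))"
  proof (rule sum.cong)
    fix i assume "i \<in> {..n}"
    then have "real (Suc n - i) * ?c (Suc n - i) = (4 * real (n - i) + 2) * ?c (n - i)"
      using central_binomial_Suc[of "n - i"] by (simp add: Suc_diff_le add.commute)
    then show "?c i * (real (Suc n - i) * ?c (Suc n - i)) / (real i + 1 + real x)
       = ?c i * ((4 * real (n - i) + 2) * ?c (n - i)) / (real i + 1 + real x)" by simp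
  qed simp
  \<comment> \<open>The power is turned back into a convolution, now for \<open>n\<close>, so that
    it combines termwise with the other sum: the coefficient 4 (i + 1 + x) + 4 (n - i) + 2 is the
    constant 4 K - 2.\<close>
  also have "4 ^ Suc n + \<dots> = 4 * (\<Sum>i\<le>n. ?c i * ?c (n - i))
      + (\<Sum>i\<le>n. ?c i * ((4 * real (n - i) + 2) * ?c (n - i)) / (real i + 1 + real x))"
    by (simp only: sum_central_binomial_convolution power_Suc)
  also have "\<dots> = (4 * K - 2) * ?f n"
    unfolding sum_distrib_left sum.distrib[symmetric]
  proof (rule sum.cong)
    fix i assume i: "i \<in> {..n}"
    define A where "A = real i + 1 + real x"
    have "A > 0" by (simp add: A_def add_nonneg_pos)
    moreover have "4 * (p * q) + p * (b * q) / a = (4 * a + b) * (p * q / a)"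
      if "a > 0" for a b p q :: real
      using that by (simp add: field_simps)
    moreover have "4 * K - 2 = 4 * A + (4 * real (n - i) + 2)"
      using i by (simp add: A_def K_def of_nat_diff)
    ultimately show "4 * (?c i * ?c (n - i)) + ?c i * ((4 * real (n - i) + 2) * ?c (n - i)) / A
        = (4 * K - 2) * (?c i * ?c (n - i) / A)"
      by (simp only:)
  qed simp
  finally have "K * (2 * ?f (Suc n)) = (4 * K - 2) * (2 * ?f n)"
    by (simp only: mult.left_commute[of _ 2])
  then have "K * (2 * ?f (Suc n)) = (4 * K - 2) * (?c (x + n + 1) / (?c x * (2 * real x + 1)))"
    by (simp only: Suc.IH)
  also have "(4 * K - 2) * (?c (x + n + 1) / (?c x * (2 * real x + 1)))
      = (4 * K - 2) * ?c (x + n + 1) / (?c x * (2 * real x + 1))" by simp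
  also have "(4 * K - 2) * ?c (x + n + 1) = K * ?c (x + Suc n + 1)"
    using central_binomial_Suc[of "x + n + 1"] by (simp add: K_def add.commute add.left_commute)
  finally have "K * (2 * ?f (Suc n)) = K * (?c (x + Suc n + 1) / (?c x * (2 * real x + 1)))"
    by (simp only: times_divide_eq_right)
  then show ?case using K by (simp only: mult_cancel_left) simp
qed

text \<open>The two denominators A and B add up to k + x + y, which does not involve
  \<open>i\<close>; hence 1/(AB) = (1/A + 1/B)/(A + B) gives two instances of
  \<open>sum_central_binomial_quotient\<close>, one after reflecting \<open>i\<close>. In the
  application \<open>x\<close> and \<open>y\<close> are 0 or lengths of other cycles.\<close>

lemma sum_central_binomial_partial_fractions:
  assumes "k \<ge> 2"
  shows "(\<Sum>i = 1..k - 1. central_binomial (i - 1) * central_binomial (k - i - 1)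
             / ((real i + real x) * (real (k - i) + real y)))
      = (central_binomial (k + x - 1) / (central_binomial x * (2 * real x + 1))
          + central_binomial (k + y - 1) / (central_binomial y * (2 * real y + 1)))
        / (2 * (real k + real x + real y))"
proof -
  let ?c = central_binomial
  define n where "n = k - 2"
  have k: "k = n + 2" using assms by (simp add: n_def)
  have "(\<Sum>i = 1..k - 1. ?c (i - 1) * ?c (k - i - 1) / ((real i + real x) * (real (k - i) + real y)))
      = (\<Sum>i\<le>n. ?c i * ?c (n - i) / ((real i + 1 + real x) * (real (n - i) + 1 + real y)))"
    by (rule sum.reindex_bij_witness[of _ Suc "\<lambda>i. i - 1"]) (auto simp: k of_nat_diff)
  also have "\<dots> = (\<Sum>i\<le>n. (?c i * ?c (n - i) / (real i + 1 + real x)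
        + ?c i * ?c (n - i) / (real (n - i) + 1 + real y)) / (real k + real x + real y))"
  proof (rule sum.cong)
    fix i assume i: "i \<in> {..n}"
    define A B where "A = real i + 1 + real x" and "B = real (n - i) + 1 + real y"
    have "A > 0" "B > 0" by (auto simp: A_def B_def)
    moreover have "p / (a * b) = (p / a + p / b) / (a + b)" if "a > 0" "b > 0" for a b p :: real
      using that by (simp add: add_frac_eq distrib_left[symmetric] add.commute[of b])
    moreover have "real k + real x + real y = A + B"
      using i by (simp add: A_def B_def k of_nat_diff)
    ultimately show "?c i * ?c (n - i) / (A * B) = (?c i * ?c (n - i) / A + ?c i * ?c (n - i) / B)
        / (real k + real x + real y)"
      by simp
  qed simp
  also have "\<dots> = ((\<Sum>i\<le>n. ?c i * ?c (n - i) / (real i + 1 + real x))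
      + (\<Sum>i\<le>n. ?c i * ?c (n - i) / (real (n - i) + 1 + real y))) / (real k + real x + real y)"
    by (simp only: sum_divide_distrib[symmetric] sum.distrib)
  also have "(\<Sum>i\<le>n. ?c i * ?c (n - i) / (real (n - i) + 1 + real y))
      = (\<Sum>i\<le>n. ?c i * ?c (n - i) / (real i + 1 + real y))"
    by (rule sum.reindex_bij_witness[of _ "\<lambda>i. n - i" "\<lambda>i. n - i"]) auto
  moreover have "k + x - 1 = x + n + 1" "k + y - 1 = y + n + 1" by (simp_all add: k)
  ultimately show ?thesis
    by (simp only: sum_central_binomial_quotient[symmetric] distrib_left[symmetric]
        mult_divide_mult_cancel_left_if) simp
qed

text \<open>In formal variables with \<open>t\<^sub>j\<^sup>2 = 0\<close>, the coefficient of the product of the \<open>t\<^sub>j\<close> in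
  \<open>\<phi>\<^sup>x\<close>, where \<open>\<phi>\<close> solves \<open>\<phi> = 1 + \<Sum>\<^sub>j t\<^sub>j \<phi> ^ (c\<^sub>j + 1)\<close>.\<close>
definition rothe :: "('a \<Rightarrow> nat) \<Rightarrow> 'a set \<Rightarrow> real \<Rightarrow> real" where
  "rothe c S x = (if S = {} then 1 else x * pochhammer (x + real (sum c S) + 1) (card S - 1))"

text \<open>This is phi^x - phi^(x-1) = sum_j t_j phi^(x + c_j), the defining equation of phi
  multiplied by phi^(x-1).\<close>

lemma rothe_backward_difference:
  assumes "finite S"
  shows "rothe c S x - rothe c S (x - 1) = (\<Sum>j\<in>S. rothe c (S - {j}) (x + real (c j)))"
proof -
  consider "S = {}" | j where "S = {j}" | m where "card S = m + 2"
    by (metis One_nat_def Suc_1 add.commute add_Suc_right assms card_0_eq card_1_singletonE not0_implies_Suc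
        plus_1_eq_Suc)
  then show ?thesis
  proof cases
    case (3 m)
    have "card (S - {j}) = Suc m" if "j \<in> S" for j
      using that 3 by (simp add: card_Diff_singleton)
    then have ne: "S \<noteq> {}" "\<And>j. j \<in> S \<Longrightarrow> S - {j} \<noteq> {}"
      using 3 by (fastforce, metis card.empty nat.distinct(1))
    define a where "a = x + real (sum c S)"
    have "rothe c (S - {j}) (x + real (c j)) = (x + real (c j)) * pochhammer (a + 1) m" if "j \<in> S" for j
      using that ne 3 assms by (simp add: rothe_def a_def sum_diff1_nat of_nat_diff member_le_sum)
    then have "(\<Sum>j\<in>S. rothe c (S - {j}) (x + real (c j))) = (\<Sum>j\<in>S. x + real (c j)) * pochhammer (a + 1) m"
      by (simp add: sum_distrib_right)
    also have "(\<Sum>j\<in>S. x + real (c j)) = (real m + 1) * x + a"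
      by (simp add: sum.distrib 3 a_def algebra_simps)
    finally have rhs: "(\<Sum>j\<in>S. rothe c (S - {j}) (x + real (c j)))
        = ((real m + 1) * x + a) * pochhammer (a + 1) m" .
    have "rothe c S x = x * (pochhammer (a + 1) m * (a + 1 + real m))"
      using ne 3 by (simp add: rothe_def a_def pochhammer_Suc)
    moreover have "rothe c S (x - 1) = (x - 1) * (a * pochhammer (a + 1) m)"
      using ne 3 by (simp add: rothe_def a_def pochhammer_rec algebra_simps)
    ultimately show ?thesis unfolding rhs by (simp add: algebra_simps)
  qed (auto simp: rothe_def)
qed

section \<open>Sums over subsets and the Rothe convolution\<close>

lemma sum_Pow_members:
  assumes "finite S"
  shows "(\<Sum>T\<in>Pow S. \<Sum>j\<in>T. f j T) = (\<Sum>j\<in>S. \<Sum>T\<in>Pow (S - {j}). f j (insert j T))"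
proof -
  have "(\<Sum>T\<in>Pow S. \<Sum>j\<in>T. f j T) = (\<Sum>(T, j)\<in>Sigma (Pow S) (\<lambda>T. T). f j T)"
    using assms by (subst sum.Sigma) (auto intro: finite_subset)
  also have "\<dots> = (\<Sum>(j, T)\<in>Sigma S (\<lambda>j. Pow (S - {j})). f j (insert j T))"
    by (rule sum.reindex_bij_witness[of _ "\<lambda>(j, T). (insert j T, j)" "\<lambda>(T, j). (j, T - {j})"])
      (auto simp: insert_absorb)
  finally show ?thesis using assms by (subst sum.Sigma) auto
qed

lemma sum_Pow_nonmembers:
  assumes "finite S"
  shows "(\<Sum>T\<in>Pow S. \<Sum>j\<in>S - T. f j T) = (\<Sum>j\<in>S. \<Sum>T\<in>Pow (S - {j}). f j T)"
proof -
  have "(\<Sum>T\<in>Pow S. \<Sum>j\<in>S - T. f j T) = (\<Sum>(T, j)\<in>Sigma (Pow S) (\<lambda>T. S - T). f j T)"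
    using assms by (subst sum.Sigma) auto
  also have "\<dots> = (\<Sum>(j, T)\<in>Sigma S (\<lambda>j. Pow (S - {j})). f j T)"
    by (rule sum.reindex_bij_witness[of _ "\<lambda>(j, T). (T, j)" "\<lambda>(T, j). (j, T)"]) auto
  finally show ?thesis using assms by (subst sum.Sigma) auto
qed

text \<open>This is phi^n phi^y = phi^(n+y). Both sides have the same backward difference in
  \<open>n\<close>, by the identity for the smaller sets S - {j}; there the first exponent becomes
  \<open>Suc n + c j\<close>, so \<open>n\<close> is arbitrary in the outer induction. At n = 0 only
  T = {} contributes.\<close>

lemma rothe_convolution:
  assumes "finite S"
  shows "(\<Sum>T\<in>Pow S. rothe c T (real n) * rothe c (S - T) y) = rothe c S (real n + y)"
  using assms
proof (induction S arbitrary: n rule: finite_psubset_induct)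
  case (psubset S)
  show ?case
  proof (induction n)
    case 0
    have "(\<Sum>T\<in>Pow S. rothe c T 0 * rothe c (S - T) y) = (\<Sum>T\<in>{{}}. rothe c T 0 * rothe c (S - T) y)"
      using psubset.hyps by (intro sum.mono_neutral_right) (auto simp: rothe_def)
    then show ?case by (simp add: rothe_def)
  next
    case (Suc n)
    let ?R = "\<lambda>n. \<Sum>T\<in>Pow S. rothe c T (real n) * rothe c (S - T) y"
    have fin: "finite T" if "T \<in> Pow S" for T using that psubset.hyps finite_subset by blast
    have "?R (Suc n) - ?R n = (\<Sum>T\<in>Pow S. (rothe c T (real (Suc n)) - rothe c T (real (Suc n) - 1)) * rothe c (S - T) y)"
      by (simp add: sum_subtractf[symmetric] algebra_simps)
    also have "\<dots> = (\<Sum>T\<in>Pow S. \<Sum>j\<in>T. rothe c (T - {j}) (real (Suc n + c j)) * rothe c (S - T) y)"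
      by (intro sum.cong refl, subst rothe_backward_difference[OF fin]) (auto simp: sum_distrib_right add.assoc)
    also have "\<dots> = (\<Sum>j\<in>S. \<Sum>T\<in>Pow (S - {j}). rothe c (insert j T - {j}) (real (Suc n + c j)) * rothe c (S - insert j T) y)"
      by (rule sum_Pow_members[OF psubset.hyps])
    also have "\<dots> = (\<Sum>j\<in>S. \<Sum>T\<in>Pow (S - {j}). rothe c T (real (Suc n + c j)) * rothe c (S - {j} - T) y)"
    proof (intro sum.cong refl)
      fix j T assume "j \<in> S" "T \<in> Pow (S - {j})"
      then have "insert j T - {j} = T" "S - insert j T = S - {j} - T" by auto
      then show "rothe c (insert j T - {j}) (real (Suc n + c j)) * rothe c (S - insert j T) y
         = rothe c T (real (Suc n + c j)) * rothe c (S - {j} - T) y" by simp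
    qed
    also have "\<dots> = (\<Sum>j\<in>S. rothe c (S - {j}) (real (Suc n + c j) + y))"
      by (intro sum.cong refl psubset.IH) auto
    also have "\<dots> = rothe c S (real (Suc n) + y) - rothe c S (real (Suc n) + y - 1)"
      by (subst rothe_backward_difference[OF psubset.hyps]) (simp add: algebra_simps)
    finally show ?case using Suc.IH by (simp add: algebra_simps)
  qed
qed

text \<open>The corresponding coefficient of
  \<open>\<phi> ^ (2 a) (1 / a - \<Sum>\<^sub>j t\<^sub>j \<phi> ^ (2 b\<^sub>j) (2 b\<^sub>j + 1) / (a + b\<^sub>j))\<close> for \<open>c\<^sub>j = 2 b\<^sub>j\<close>. The lemma
  \<open>branch_eq_rising\<close> shows that the rising products of the theorem are of this form, which
  turns the sums over subsets in the cut term into Rothe convolutions.\<close>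
definition branch :: "('a \<Rightarrow> nat) \<Rightarrow> 'a set \<Rightarrow> nat \<Rightarrow> real" where
  "branch b S a = rothe (\<lambda>j. 2 * b j) S (2 * real a) / real a
     - (\<Sum>j\<in>S. (2 * real (b j) + 1) / (real a + real (b j))
          * rothe (\<lambda>j. 2 * b j) (S - {j}) (2 * real a + 2 * real (b j)))"

text \<open>With D = 2 (a + sum b S) + 1 and |S| = m + 2, all terms of \<open>branch\<close> share
  the factor \<open>pochhammer D m\<close>, and D + m - (2 sum b S + m + 2) = 2a - 1;
  \<open>central_binomial_pred\<close> absorbs this factor. Sets with at most one element are
  treated separately, because the exponents -2 and -1 fall under the negative convention of
  \<open>rising\<close>.\<close>

lemma branch_eq_rising:
  assumes "finite S" "a \<ge> 1"
  shows "central_binomial (a - 1) * branch b S a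
     = real a * central_binomial a * rising (2 * real (a + sum b S) + 1) (int (card S) - 2)"
proof -
  have a: "real a \<ge> 1" using assms by simp
  have "branch b S a = 2 * (2 * real a - 1) * rising (2 * real (a + sum b S) + 1) (int (card S) - 2)"
  proof -
    consider "S = {}" | j where "S = {j}" | m where "card S = m + 2"
      by (metis One_nat_def Suc_1 add.commute add_Suc_right assms(1) card_0_eq card_1_singletonE
          not0_implies_Suc plus_1_eq_Suc)
    then show ?thesis
    proof cases
      case 1
      have "pochhammer (2 * real a - 1) 2 = (2 * real a - 1) * (2 * real a)"
        by (simp add: numeral_2_eq_2 pochhammer_Suc)
      moreover have "2 * y * (1 / (y * (2 * x))) = 1 / x" if "y > 0" for x y :: real
        using that by simp
      moreover have "2 * real a - 1 > 0" using a by linarith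
      moreover have "branch b S a = 1 / real a"
        using 1 by (simp add: branch_def rothe_def)
      moreover have "rising (2 * real (a + sum b S) + 1) (int (card S) - 2) = 1 / pochhammer (2 * real a - 1) 2"
        using 1 by (simp add: rising_def)
      ultimately show ?thesis by (simp only:)
    next
      case (2 j)
      have "1 / x * (2 * x) - (2 * y + 1) / (x + y) = 2 * (2 * x - 1) / (2 * (x + y))"
        if "x \<ge> 1" "y \<ge> 0" for x y :: real
        using that by (simp add: field_simps)
      from this[OF a, of "real (b j)"] show ?thesis using a 2
        by (simp add: branch_def rothe_def rising_def)
    next
      case (3 m)
      define D where "D = 2 * real (a + sum b S) + 1"
      define p where "p = pochhammer D m"
      have "card (S - {j}) = Suc m" if "j \<in> S" for j
        using that 3 by (simp add: card_Diff_singleton)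
      then have ne: "S \<noteq> {}" "\<And>j. j \<in> S \<Longrightarrow> S - {j} \<noteq> {}"
        using 3 by (fastforce, metis card.empty nat.distinct(1))
      have D1: "2 * real a + real (\<Sum>j\<in>S. 2 * b j) + 1 = D"
        by (simp add: D_def sum_distrib_left)
      have "rothe (\<lambda>j. 2 * b j) S (2 * real a) = 2 * real a * (p * (D + real m))"
        unfolding rothe_def D1 using 3 ne by (simp add: p_def pochhammer_Suc)
      moreover have "(2 * real (b j) + 1) / (real a + real (b j))
            * rothe (\<lambda>j. 2 * b j) (S - {j}) (2 * real a + 2 * real (b j))
          = (2 * real (b j) + 1) * (2 * p)" if "j \<in> S" for j
      proof -
        have "real (\<Sum>j\<in>S. 2 * b j) = 2 * real (b j) + real (\<Sum>j\<in>S - {j}. 2 * b j)"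
          by (simp add: sum.remove[OF assms(1) that])
        then have "2 * real a + 2 * real (b j) + real (\<Sum>j\<in>S - {j}. 2 * b j) + 1 = D"
          using D1 by linarith
        then have "rothe (\<lambda>j. 2 * b j) (S - {j}) (2 * real a + 2 * real (b j))
            = 2 * (real a + real (b j)) * p"
          unfolding rothe_def using 3 ne that by (simp add: p_def)
        moreover have "real a + real (b j) \<noteq> 0" using a by linarith
        moreover have "x / y * (2 * y * p) = x * (2 * p)" if "y \<noteq> 0" for x y :: real
          using that by simp
        ultimately show ?thesis by (simp only:)
      qed
      ultimately have "branch b S a = 2 * (p * (D + real m)) - (\<Sum>j\<in>S. (2 * real (b j) + 1) * (2 * p))"
        using a by (simp add: branch_def)
      also have "(\<Sum>j\<in>S. (2 * real (b j) + 1) * (2 * p)) = (2 * real (sum b S) + real (m + 2)) * (2 * p)"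
        unfolding sum_distrib_right[symmetric] by (simp add: sum.distrib sum_distrib_left 3)
      finally have "branch b S a = 2 * (2 * real a - 1) * p"
        by (simp add: D_def algebra_simps)
      then show ?thesis using 3 by (simp add: rising_def p_def D_def)
    qed
  qed
  then show ?thesis using central_binomial_pred[OF assms(2)] by simp
qed

text \<open>Coefficient form of the product of the series behind the two branches. On the right,
  \<open>i\<close> and \<open>l\<close> enter the Rothe factors only through i + l, which is
  constant when a cycle is cut; all other dependence on them sits in the reciprocals.\<close>

lemma branch_convolution:
  assumes "finite S"
  shows "(\<Sum>T\<in>Pow S. branch b T i * branch b (S - T) l)
    = rothe (\<lambda>j. 2 * b j) S (2 * real (i + l)) / (real i * real l)
      - (\<Sum>j\<in>S. (2 * real (b j) + 1) * rothe (\<lambda>j. 2 * b j) (S - {j}) (2 * real (i + l + b j))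
           * (1 / ((real i + real (b j)) * real l) + 1 / (real i * (real l + real (b j)))))
      + (\<Sum>j\<in>S. \<Sum>h\<in>S - {j}. (2 * real (b j) + 1) * (2 * real (b h) + 1)
           * rothe (\<lambda>j. 2 * b j) (S - {j} - {h}) (2 * real (i + l + b j + b h))
           * (1 / ((real i + real (b j)) * (real l + real (b h)))))"
proof -
  define P where "P = rothe (\<lambda>j. 2 * b j)"
  define g where "g i j = (2 * real (b j) + 1) / (real i + real (b j))" for i j
  have br: "branch b T a = P T (2 * real a) / real a - (\<Sum>j\<in>T. g a j * P (T - {j}) (2 * real (a + b j)))" for T a
    by (simp add: branch_def P_def g_def)
  have conv: "(\<Sum>T\<in>Pow U. P T (2 * real x) * P (U - T) (2 * real y)) = P U (2 * real (x + y))"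
    if "U \<subseteq> S" for U x y
    using rothe_convolution[of U "\<lambda>j. 2 * b j" "2 * x" "2 * real y"] that assms
    by (simp add: P_def finite_subset)
  have fT: "finite T" if "T \<in> Pow S" for T using that assms finite_subset by blast
  \<comment> \<open>Four sums arise, according to whether an element j of \<open>T\<close>, an
    element h of \<open>S - T\<close>, both or neither are singled out. Exchanging summations leaves
    a sum over subsets of the remaining elements, which \<open>conv\<close> evaluates.\<close>
  have "(\<Sum>T\<in>Pow S. branch b T i * branch b (S - T) l)
     = (\<Sum>T\<in>Pow S. P T (2 * real i) * P (S - T) (2 * real l) / (real i * real l))
      - (\<Sum>T\<in>Pow S. \<Sum>j\<in>T. g i j / real l * (P (T - {j}) (2 * real (i + b j)) * P (S - T) (2 * real l)))
      - (\<Sum>T\<in>Pow S. \<Sum>h\<in>S - T. g l h / real i * (P T (2 * real i) * P (S - T - {h}) (2 * real (l + b h))))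
      + (\<Sum>T\<in>Pow S. \<Sum>j\<in>T. \<Sum>h\<in>S - T. g i j * g l h
            * (P (T - {j}) (2 * real (i + b j)) * P (S - T - {h}) (2 * real (l + b h))))"
    unfolding sum_subtractf[symmetric] sum.distrib[symmetric]
  proof (rule sum.cong)
    fix T
    define A B C D where "A = P T (2 * real i)" and "B = P (S - T) (2 * real l)"
      and "C = (\<lambda>j. P (T - {j}) (2 * real (i + b j)))" and "D = (\<lambda>h. P (S - T - {h}) (2 * real (l + b h)))"
    show "branch b T i * branch b (S - T) l = P T (2 * real i) * P (S - T) (2 * real l) / (real i * real l)
      - (\<Sum>j\<in>T. g i j / real l * (P (T - {j}) (2 * real (i + b j)) * P (S - T) (2 * real l)))
      - (\<Sum>h\<in>S - T. g l h / real i * (P T (2 * real i) * P (S - T - {h}) (2 * real (l + b h))))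
      + (\<Sum>j\<in>T. \<Sum>h\<in>S - T. g i j * g l h
            * (P (T - {j}) (2 * real (i + b j)) * P (S - T - {h}) (2 * real (l + b h))))"
      unfolding br A_def[symmetric] B_def[symmetric] C_def[symmetric, THEN fun_cong] D_def[symmetric, THEN fun_cong]
    proof -
      have "(\<Sum>j\<in>T. g i j / real l * (C j * B)) = (\<Sum>j\<in>T. g i j * C j) * (B / real l)"
        unfolding sum_distrib_right by (intro sum.cong) simp_all
      moreover have "(\<Sum>h\<in>S - T. g l h / real i * (A * D h)) = (A / real i) * (\<Sum>h\<in>S - T. g l h * D h)"
        by (simp add: sum_distrib_left ac_simps)
      moreover have "(\<Sum>j\<in>T. \<Sum>h\<in>S - T. g i j * g l h * (C j * D h))
          = (\<Sum>j\<in>T. g i j * C j) * (\<Sum>h\<in>S - T. g l h * D h)"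
        by (simp add: sum_product ac_simps)
      ultimately show "(A / real i - (\<Sum>j\<in>T. g i j * C j)) * (B / real l - (\<Sum>h\<in>S - T. g l h * D h))
         = A * B / (real i * real l) - (\<Sum>j\<in>T. g i j / real l * (C j * B))
           - (\<Sum>h\<in>S - T. g l h / real i * (A * D h))
           + (\<Sum>j\<in>T. \<Sum>h\<in>S - T. g i j * g l h * (C j * D h))"
        by (simp add: left_diff_distrib right_diff_distrib diff_divide_distrib)
    qed
  qed simp
  also have "(\<Sum>T\<in>Pow S. P T (2 * real i) * P (S - T) (2 * real l) / (real i * real l))
     = P S (2 * real (i + l)) / (real i * real l)"
    by (simp only: sum_divide_distrib[symmetric] conv[OF subset_refl])
  also have "(\<Sum>T\<in>Pow S. \<Sum>j\<in>T. g i j / real l * (P (T - {j}) (2 * real (i + b j)) * P (S - T) (2 * real l)))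
     = (\<Sum>j\<in>S. g i j / real l * P (S - {j}) (2 * real (i + b j + l)))"
    unfolding sum_Pow_members[OF assms]
  proof (intro sum.cong refl)
    fix j assume j: "j \<in> S"
    have "(\<Sum>T\<in>Pow (S - {j}). g i j / real l * (P (insert j T - {j}) (2 * real (i + b j)) * P (S - insert j T) (2 * real l)))
      = (\<Sum>T\<in>Pow (S - {j}). g i j / real l * (P T (2 * real (i + b j)) * P (S - {j} - T) (2 * real l)))"
      by (intro sum.cong refl arg_cong2[of _ _ _ _ "(*)"] arg_cong2[of _ _ _ _ P]) auto
    then show "(\<Sum>T\<in>Pow (S - {j}). g i j / real l * (P (insert j T - {j}) (2 * real (i + b j)) * P (S - insert j T) (2 * real l)))
       = g i j / real l * P (S - {j}) (2 * real (i + b j + l))"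
      by (simp only: sum_distrib_left[symmetric] conv[OF Diff_subset])
  qed
  also have "(\<Sum>T\<in>Pow S. \<Sum>h\<in>S - T. g l h / real i * (P T (2 * real i) * P (S - T - {h}) (2 * real (l + b h))))
     = (\<Sum>h\<in>S. g l h / real i * P (S - {h}) (2 * real (i + (l + b h))))"
    unfolding sum_Pow_nonmembers[OF assms]
  proof (intro sum.cong refl)
    fix h assume h: "h \<in> S"
    have "(\<Sum>T\<in>Pow (S - {h}). g l h / real i * (P T (2 * real i) * P (S - T - {h}) (2 * real (l + b h))))
      = (\<Sum>T\<in>Pow (S - {h}). g l h / real i * (P T (2 * real i) * P (S - {h} - T) (2 * real (l + b h))))"
      by (intro sum.cong refl arg_cong2[of _ _ _ _ "(*)"] arg_cong2[of _ _ _ _ P]) auto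
    then show "(\<Sum>T\<in>Pow (S - {h}). g l h / real i * (P T (2 * real i) * P (S - T - {h}) (2 * real (l + b h))))
       = g l h / real i * P (S - {h}) (2 * real (i + (l + b h)))"
      by (simp only: sum_distrib_left[symmetric] conv[OF Diff_subset])
  qed
  also have "(\<Sum>T\<in>Pow S. \<Sum>j\<in>T. \<Sum>h\<in>S - T. g i j * g l h
            * (P (T - {j}) (2 * real (i + b j)) * P (S - T - {h}) (2 * real (l + b h))))
     = (\<Sum>j\<in>S. \<Sum>h\<in>S - {j}. g i j * g l h * P (S - {j} - {h}) (2 * real (i + b j + (l + b h))))"
    unfolding sum_Pow_members[OF assms]
  proof (intro sum.cong refl)
    fix j assume j: "j \<in> S"
    have "(\<Sum>T\<in>Pow (S - {j}). \<Sum>h\<in>S - insert j T. g i j * g l h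
            * (P (insert j T - {j}) (2 * real (i + b j)) * P (S - insert j T - {h}) (2 * real (l + b h))))
      = (\<Sum>T\<in>Pow (S - {j}). \<Sum>h\<in>S - {j} - T. g i j * g l h
            * (P T (2 * real (i + b j)) * P (S - {j} - {h} - T) (2 * real (l + b h))))"
      by (intro sum.cong refl arg_cong2[of _ _ _ _ "(*)"] arg_cong2[of _ _ _ _ P]) auto
    also have "\<dots> = (\<Sum>h\<in>S - {j}. \<Sum>T\<in>Pow (S - {j} - {h}). g i j * g l h
            * (P T (2 * real (i + b j)) * P (S - {j} - {h} - T) (2 * real (l + b h))))"
      using assms by (intro sum_Pow_nonmembers) auto
    also have "\<dots> = (\<Sum>h\<in>S - {j}. g i j * g l h * P (S - {j} - {h}) (2 * real (i + b j + (l + b h))))"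
      by (intro sum.cong refl, subst sum_distrib_left[symmetric], subst conv) auto
    finally show "(\<Sum>T\<in>Pow (S - {j}). \<Sum>h\<in>S - insert j T. g i j * g l h
            * (P (insert j T - {j}) (2 * real (i + b j)) * P (S - insert j T - {h}) (2 * real (l + b h))))
      = (\<Sum>h\<in>S - {j}. g i j * g l h * P (S - {j} - {h}) (2 * real (i + b j + (l + b h))))" .
  qed
  also have "(\<Sum>j\<in>S. \<Sum>h\<in>S - {j}. g i j * g l h * P (S - {j} - {h}) (2 * real (i + b j + (l + b h))))
     = (\<Sum>j\<in>S. \<Sum>h\<in>S - {j}. (2 * real (b j) + 1) * (2 * real (b h) + 1)
           * P (S - {j} - {h}) (2 * real (i + l + b j + b h))
           * (1 / ((real i + real (b j)) * (real l + real (b h)))))"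
    by (intro sum.cong refl) (simp add: g_def ac_simps)
  also have "P S (2 * real (i + l)) / (real i * real l)
      - (\<Sum>j\<in>S. g i j / real l * P (S - {j}) (2 * real (i + b j + l)))
      - (\<Sum>h\<in>S. g l h / real i * P (S - {h}) (2 * real (i + (l + b h))))
     = P S (2 * real (i + l)) / (real i * real l)
      - (\<Sum>j\<in>S. (2 * real (b j) + 1) * P (S - {j}) (2 * real (i + l + b j))
           * (1 / ((real i + real (b j)) * real l) + 1 / (real i * (real l + real (b j)))))"
    unfolding diff_diff_eq sum.distrib[symmetric]
    by (intro arg_cong2[of _ _ _ _ "(-)"] sum.cong refl) (simp add: g_def distrib_left ac_simps)
  finally show ?thesis unfolding P_def .
qed

section \<open>The join-cut recursion satisfied by the closed formula\<close>

text \<open>The rule is uniform across the sign change of the exponent. For negative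
  \<open>k\<close> the factor a + k is cancelled from the denominator, so it must not
  vanish.\<close>

lemma rising_rec:
  assumes "a + of_int k \<noteq> 0"
  shows "rising a (k + 1) = (a + of_int k) * rising a k"
proof (cases "k \<ge> 0")
  case True
  then show ?thesis
    by (simp add: rising_def nat_add_distrib pochhammer_Suc)
next
  case False
  define n where "n = nat (- k) - 1"
  have k: "k = - int n - 1" using False by (simp add: n_def)
  have "pochhammer (a + of_int k) (Suc n) = (a + of_int k) * pochhammer (a + of_int k + 1) n"
    by (rule pochhammer_rec)
  moreover have "rising a (k + 1) = 1 / pochhammer (a + of_int k + 1) n"
    by (cases n) (simp_all add: rising_def k nat_add_distrib algebra_simps)
  moreover have "rising a k = 1 / pochhammer (a + of_int k) (Suc n)"
    using False by (simp add: rising_def k nat_add_distrib)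
  ultimately show ?thesis using assms by simp
qed

text \<open>\<open>F k S\<close> is the planar count with a marked cycle of length \<open>k\<close>,
  stripped of the factors b_j C_(b_j) of the other cycles. A join with cycle j can happen at b_j
  points and makes its factor disappear, whence the division by
  \<open>central_binomial (b j)\<close>. A cut gives lengths i and k - i and distributes
  \<open>S\<close>. The last hypothesis excludes the one-point set, where there is no transposition
  to remove.\<close>

theorem branch_join_cut:
  fixes b :: "'a \<Rightarrow> nat" and k :: nat
  defines "F \<equiv> \<lambda>k S. central_binomial (k - 1) * branch b S k"
  assumes "finite S" "k \<ge> 1" "k \<ge> 2 \<or> S \<noteq> {}"
  shows "F k S = (\<Sum>j\<in>S. F (k + b j) (S - {j}) / central_binomial (b j))
      + (\<Sum>i = 1..k - 1. \<Sum>T\<in>Pow S. F i T * F (k - i) (S - T))"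
\<comment> \<open>For k = 1 nothing can be cut, and the identity is one step of the rising product;
  for k >= 2 the cut term is evaluated in closed form.\<close>
proof (cases "k \<ge> 2")
  case False
  then have k: "k = 1" and S: "card S \<ge> 1" using assms(2-4) by (auto simp: card_gt_0_iff Suc_le_eq)
  define D where "D = 2 * real (1 + sum b S) + 1"
  have F: "F k S = 2 * rising D (int (card S) - 3 + 1)"
    unfolding F_def by (subst branch_eq_rising) (use assms k in \<open>simp_all add: D_def central_binomial_def\<close>)
  have "F (k + b j) (S - {j}) / central_binomial (b j) = (4 * real (b j) + 2) * rising D (int (card S) - 3)"
    if j: "j \<in> S" for j
  proof -
    have "F (k + b j) (S - {j}) = real (1 + b j) * central_binomial (1 + b j)
        * rising (2 * real (1 + b j + sum b (S - {j})) + 1) (int (card (S - {j})) - 2)"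
      unfolding F_def k using assms(2) by (subst branch_eq_rising) simp_all
    also have "1 + b j + sum b (S - {j}) = 1 + sum b S"
      using sum.remove[OF assms(2) j, of b] by simp
    also have "int (card (S - {j})) - 2 = int (card S) - 3"
      using S j assms(2) by (simp add: card_Diff_singleton of_nat_diff)
    also have "real (1 + b j) * central_binomial (1 + b j) = (4 * real (b j) + 2) * central_binomial (b j)"
      using central_binomial_Suc[of "b j"] by (simp add: add.commute)
    finally show ?thesis by (simp add: D_def)
  qed
  then have "(\<Sum>j\<in>S. F (k + b j) (S - {j}) / central_binomial (b j))
      = (4 * real (sum b S) + 2 * real (card S)) * rising D (int (card S) - 3)"
    by (simp add: sum_distrib_right[symmetric] sum.distrib sum_distrib_left)
  also have "\<dots> = 2 * ((D + of_int (int (card S) - 3)) * rising D (int (card S) - 3))"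
    by (simp add: D_def algebra_simps)
  also have "\<dots> = F k S"
  proof -
    have "D + of_int (int (card S) - 3) = 2 * real (sum b S) + real (card S)"
      by (simp add: D_def)
    moreover have "real (card S) \<ge> 1" using S by simp
    ultimately have "D + of_int (int (card S) - 3) \<noteq> 0" by linarith
    then show ?thesis unfolding F by (subst rising_rec) simp_all
  qed
  finally show ?thesis using k by simp
next
  case k: True
  define P where "P = rothe (\<lambda>j. 2 * b j)"
  define e where "e j = 2 * real (b j) + 1" for j
  \<comment> \<open>The normalisation makes \<open>v 0\<close> the central binomial in
    \<open>F k S\<close>, and \<open>e j * v (b j) * central_binomial (b j)\<close> the one in
    \<open>F (k + b j) (S - {j})\<close>.\<close>
  define v where "v x = central_binomial (k + x - 1) / (central_binomial x * (2 * real x + 1))" for x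
  let ?c = "\<lambda>i. central_binomial (i - 1) * central_binomial (k - i - 1)"
  have pf: "(\<Sum>i = 1..k - 1. ?c i * (1 / ((real i + real x) * (real (k - i) + real y))))
      = (v x + v y) / (2 * (real k + real x + real y))" for x y
    using sum_central_binomial_partial_fractions[OF k, of x y] by (simp add: v_def)
  have v0: "v 0 = central_binomial (k - 1)" by (simp add: v_def)
  have "(\<Sum>i = 1..k - 1. \<Sum>T\<in>Pow S. F i T * F (k - i) (S - T))
     = (\<Sum>i = 1..k - 1. ?c i * (\<Sum>T\<in>Pow S. branch b T i * branch b (S - T) (k - i)))"
    by (simp add: F_def sum_distrib_left ac_simps)
  also have "\<dots> = (\<Sum>i = 1..k - 1. P S (2 * real k) * (?c i * (1 / (real i * real (k - i))))
      - (\<Sum>j\<in>S. e j * P (S - {j}) (2 * real (k + b j))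
           * (?c i * (1 / ((real i + real (b j)) * real (k - i))) + ?c i * (1 / (real i * (real (k - i) + real (b j))))))
      + (\<Sum>j\<in>S. \<Sum>h\<in>S - {j}. e j * e h
           * P (S - {j} - {h}) (2 * real (k + b j + b h))
           * (?c i * (1 / ((real i + real (b j)) * (real (k - i) + real (b h)))))))"
  proof (intro sum.cong refl)
    fix i assume "i \<in> {1..k - 1}"
    then have ik: "i + (k - i) = k" by auto
    show "?c i * (\<Sum>T\<in>Pow S. branch b T i * branch b (S - T) (k - i)) = P S (2 * real k) * (?c i * (1 / (real i * real (k - i))))
      - (\<Sum>j\<in>S. e j * P (S - {j}) (2 * real (k + b j))
           * (?c i * (1 / ((real i + real (b j)) * real (k - i))) + ?c i * (1 / (real i * (real (k - i) + real (b j))))))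
      + (\<Sum>j\<in>S. \<Sum>h\<in>S - {j}. e j * e h
           * P (S - {j} - {h}) (2 * real (k + b j + b h))
           * (?c i * (1 / ((real i + real (b j)) * (real (k - i) + real (b h))))))"
      unfolding branch_convolution[OF assms(2)] ik P_def[symmetric] e_def[symmetric]
        distrib_left[of "?c i"] right_diff_distrib sum_distrib_left
      by (intro arg_cong2[of _ _ _ _ "(+)"] arg_cong2[of _ _ _ _ "(-)"] sum.cong refl)
        (simp_all only: distrib_left ac_simps times_divide_eq_right mult_1_right mult_1_left)
  qed
  also have "\<dots> = P S (2 * real k) * (\<Sum>i = 1..k - 1. ?c i * (1 / (real i * real (k - i))))
      - (\<Sum>j\<in>S. e j * P (S - {j}) (2 * real (k + b j))
           * ((\<Sum>i = 1..k - 1. ?c i * (1 / ((real i + real (b j)) * real (k - i))))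
             + (\<Sum>i = 1..k - 1. ?c i * (1 / (real i * (real (k - i) + real (b j)))))))
      + (\<Sum>j\<in>S. \<Sum>h\<in>S - {j}. e j * e h
           * P (S - {j} - {h}) (2 * real (k + b j + b h))
           * (\<Sum>i = 1..k - 1. ?c i * (1 / ((real i + real (b j)) * (real (k - i) + real (b h))))))"
  proof -
    have "(\<Sum>i\<in>I. \<Sum>j\<in>S. f j * (g i j + h i j)) = (\<Sum>j\<in>S. f j * ((\<Sum>i\<in>I. g i j) + (\<Sum>i\<in>I. h i j)))"
      for I :: "nat set" and f :: "'a \<Rightarrow> real" and g h
      by (subst sum.swap) (simp add: sum_distrib_left sum.distrib distrib_left)
    moreover have "(\<Sum>i\<in>I. \<Sum>j\<in>S. \<Sum>h\<in>S - {j}. f j h * g i j h) = (\<Sum>j\<in>S. \<Sum>h\<in>S - {j}. f j h * (\<Sum>i\<in>I. g i j h))"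
      for I :: "nat set" and f :: "'a \<Rightarrow> 'a \<Rightarrow> real" and g
      by (subst sum.swap, intro sum.cong refl, subst sum.swap) (simp add: sum_distrib_left)
    ultimately show ?thesis
      by (simp only: sum.distrib sum_subtractf sum_distrib_left[symmetric])
  qed
  also have "\<dots> = P S (2 * real k) * (v 0 / real k)
      - (\<Sum>j\<in>S. e j * P (S - {j}) (2 * real (k + b j)) * ((v (b j) + v 0) / (real k + real (b j))))
      + (\<Sum>j\<in>S. \<Sum>h\<in>S - {j}. e j * e h
           * P (S - {j} - {h}) (2 * real (k + b j + b h))
           * ((v (b j) + v (b h)) / (2 * (real k + real (b j) + real (b h)))))"
  proof -
    have "(\<Sum>i = 1..k - 1. ?c i * (1 / (real i * real (k - i)))) = v 0 / real k"
      using pf[of 0 0] by simp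
    moreover have "(\<Sum>i = 1..k - 1. ?c i * (1 / ((real i + real x) * real (k - i))))
        = (v x + v 0) / (2 * (real k + real x))" for x
      using pf[of x 0] by simp
    moreover have "(\<Sum>i = 1..k - 1. ?c i * (1 / (real i * (real (k - i) + real x))))
        = (v x + v 0) / (2 * (real k + real x))" for x
      using pf[of 0 x] by (simp add: add.commute)
    moreover have "z / (2 * y) + z / (2 * y) = z / y" for y z :: real
      by simp
    ultimately show ?thesis by (simp only: pf)
  qed
  \<comment> \<open>The remaining weight is symmetric in j and h, so the mean of
    \<open>v (b j)\<close> and \<open>v (b h)\<close> can be replaced by \<open>v (b j)\<close>.
    Afterwards every term belongs to a single j.\<close>
  also have "(\<Sum>j\<in>S. \<Sum>h\<in>S - {j}. e j * e h * P (S - {j} - {h}) (2 * real (k + b j + b h))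
           * ((v (b j) + v (b h)) / (2 * (real k + real (b j) + real (b h)))))
     = (\<Sum>j\<in>S. \<Sum>h\<in>S - {j}. e j * e h * P (S - {j} - {h}) (2 * real (k + b j + b h))
           * (v (b j) / (real k + real (b j) + real (b h))))"
  proof -
    define X where "X j h = e j * e h * P (S - {j} - {h}) (2 * real (k + b j + b h))
      / (2 * (real k + real (b j) + real (b h)))" for j h
    have X: "X j h = X h j" for j h
      by (simp add: X_def Diff_insert2[symmetric] insert_commute ac_simps)
    have swap: "(\<Sum>j\<in>S. \<Sum>h\<in>S - {j}. f j h) = (\<Sum>j\<in>S. \<Sum>h\<in>S - {j}. f h j)" for f :: "'a \<Rightarrow> 'a \<Rightarrow> real"
      using assms(2) by (subst (1 2) sum.Sigma)
        (auto intro!: sum.reindex_bij_witness[of _ "\<lambda>(j, h). (h, j)" "\<lambda>(j, h). (h, j)"])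
    have "(\<Sum>j\<in>S. \<Sum>h\<in>S - {j}. e j * e h * P (S - {j} - {h}) (2 * real (k + b j + b h))
           * ((v (b j) + v (b h)) / (2 * (real k + real (b j) + real (b h)))))
      = (\<Sum>j\<in>S. \<Sum>h\<in>S - {j}. X j h * v (b j)) + (\<Sum>j\<in>S. \<Sum>h\<in>S - {j}. X j h * v (b h))"
      unfolding sum.distrib[symmetric]
      by (intro sum.cong refl) (simp add: X_def distrib_left add_divide_distrib)
    also have "(\<Sum>j\<in>S. \<Sum>h\<in>S - {j}. X j h * v (b h)) = (\<Sum>j\<in>S. \<Sum>h\<in>S - {j}. X j h * v (b j))"
      by (subst swap) (simp only: X)
    also have "(\<Sum>j\<in>S. \<Sum>h\<in>S - {j}. X j h * v (b j)) + \<dots> = (\<Sum>j\<in>S. \<Sum>h\<in>S - {j}. 2 * X j h * v (b j))"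
      by (simp add: sum.distrib[symmetric] mult.assoc)
    also have "\<dots> = (\<Sum>j\<in>S. \<Sum>h\<in>S - {j}. e j * e h * P (S - {j} - {h}) (2 * real (k + b j + b h))
           * (v (b j) / (real k + real (b j) + real (b h))))"
    proof -
      have "2 * (x / (2 * y)) * z = x * (z / y)" for x y z :: real by simp
      then show ?thesis unfolding X_def by (simp only:)
    qed
    finally show ?thesis .
  qed
  \<comment> \<open>The terms with \<open>v 0\<close> make up \<open>F k S\<close>; those with
    \<open>v (b j)\<close> are minus the contribution of the join with j.\<close>
  also have "P S (2 * real k) * (v 0 / real k)
      - (\<Sum>j\<in>S. e j * P (S - {j}) (2 * real (k + b j)) * ((v (b j) + v 0) / (real k + real (b j))))
      + (\<Sum>j\<in>S. \<Sum>h\<in>S - {j}. e j * e h * P (S - {j} - {h}) (2 * real (k + b j + b h))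
           * (v (b j) / (real k + real (b j) + real (b h))))
    = F k S - (\<Sum>j\<in>S. F (k + b j) (S - {j}) / central_binomial (b j))"
  proof -
    have "F k S = P S (2 * real k) * (v 0 / real k)
        - (\<Sum>j\<in>S. e j * P (S - {j}) (2 * real (k + b j)) * (v 0 / (real k + real (b j))))"
      by (simp add: F_def branch_def P_def e_def v0 right_diff_distrib sum_distrib_left ac_simps)
    moreover have "F (k + b j) (S - {j}) / central_binomial (b j)
        = e j * P (S - {j}) (2 * real (k + b j)) * (v (b j) / (real k + real (b j)))
          - (\<Sum>h\<in>S - {j}. e j * e h * P (S - {j} - {h}) (2 * real (k + b j + b h))
               * (v (b j) / (real k + real (b j) + real (b h))))" for j
    proof -
      have "e j > 0" by (simp add: e_def)
      then have c: "central_binomial (k + b j - 1) = e j * v (b j) * central_binomial (b j)"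
        by (simp add: v_def e_def[symmetric])
      have "F (k + b j) (S - {j}) / central_binomial (b j) = e j * v (b j) * branch b (S - {j}) (k + b j)"
        unfolding F_def c by simp
      then show ?thesis
        unfolding branch_def P_def[symmetric] e_def[symmetric]
        by (simp add: right_diff_distrib sum_distrib_left ac_simps)
    qed
    ultimately show ?thesis
      by (simp add: sum_subtractf sum.distrib distrib_left add_divide_distrib)
  qed
  finally show ?thesis by simp
qed

section \<open>Cycles of a permutation times a transposition\<close>

lemma orbit_eq_of_mem:
  assumes "permutation p" "y \<in> orbit p x"
  shows "orbit p y = orbit p x"
  using assms by (intro orbit_cyclic_eq3 cyclic_on_orbit')

lemma orbit_subset_invariant:
  assumes "x \<in> A" "p ` A \<subseteq> A"
  shows "orbit p x \<subseteq> A"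
proof
  fix y assume "y \<in> orbit p x"
  then show "y \<in> A" by induction (use assms in auto)
qed

lemma permutation_comp_transpose:
  assumes "permutation p"
  shows "permutation (p \<circ> Transposition.transpose s m)"
  by (intro permutation_compose assms permutation_swap_id)

lemma comp_transpose_twice [simp]:
  "p \<circ> Transposition.transpose s m \<circ> Transposition.transpose s m = p"
  by (simp add: comp_assoc)

text \<open>The product sends m to p s and s to p m and agrees with \<open>p\<close> elsewhere. Its
  cycle through m therefore first runs through the old cycle of s and, on leaving s, through the old
  cycle of m.\<close>

lemma orbit_comp_transpose_join:
  assumes p: "permutation p" and "s \<notin> orbit p m"
  shows "orbit (p \<circ> Transposition.transpose s m) m = orbit p m \<union> orbit p s"
    and "x \<notin> orbit p m \<Longrightarrow> x \<notin> orbit p s \<Longrightarrow> orbit (p \<circ> Transposition.transpose s m) x = orbit p x"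
proof -
  let ?q = "p \<circ> Transposition.transpose s m"
  have q: "permutation ?q" by (rule permutation_comp_transpose[OF p])
  have self: "x \<in> orbit p x" for x by (rule permutation_self_in_orbit[OF p])
  have m: "m \<notin> orbit p s" using assms(2) orbit_eq_of_mem[OF p, of m s] self[of s] by auto
  have sub: "orbit p b \<subseteq> orbit (p \<circ> Transposition.transpose b c) c" if "c \<notin> orbit p b" for b c
  proof
    fix y assume "y \<in> orbit p b"
    then show "y \<in> orbit (p \<circ> Transposition.transpose b c) c"
    proof induction
      case base
      show ?case by (rule orbit_eqI) simp
    next
      case (step y)
      show ?case
      proof (cases "y = b")
        case True
        then show ?thesis by (intro orbit_eqI) simp
      next
        case False
        moreover have "y \<noteq> c" using step.hyps that by auto
        ultimately have "(p \<circ> Transposition.transpose b c) y = p y" by simp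
        then show ?thesis using orbit.step[OF step.IH] by simp
      qed
    qed
  qed
  have "orbit p s \<subseteq> orbit ?q m" using sub[OF m] .
  moreover have "orbit p m \<subseteq> orbit ?q s"
    using sub[OF assms(2)] by (simp add: transpose_commute)
  moreover have "orbit ?q s = orbit ?q m"
    by (rule orbit_eq_of_mem[OF q]) (use \<open>orbit p s \<subseteq> orbit ?q m\<close> self[of s] in auto)
  moreover have "orbit ?q m \<subseteq> orbit p m \<union> orbit p s"
  proof (rule orbit_subset_invariant)
    show "m \<in> orbit p m \<union> orbit p s" using self by simp
    have "?q x \<in> orbit p m \<union> orbit p s" if "x \<in> orbit p m \<union> orbit p s" for x
      using that by (cases "x = m"; cases "x = s") (auto intro: orbit.intros)
    then show "?q ` (orbit p m \<union> orbit p s) \<subseteq> orbit p m \<union> orbit p s" by blast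
  qed
  ultimately show "orbit ?q m = orbit p m \<union> orbit p s" by blast
  show "orbit ?q x = orbit p x" if "x \<notin> orbit p m" "x \<notin> orbit p s"
  proof (rule orbit_cong[OF self])
    fix y assume "y \<in> orbit p x"
    then have "orbit p y = orbit p x" by (rule orbit_eq_of_mem[OF p])
    then have "y \<noteq> m" "y \<noteq> s" using that self[of x] by auto
    then show "?q y = p y" by simp
  qed
qed

text \<open>The product sends s = p^i m to p m and then follows \<open>p\<close> through p^2 m up to
  p^i m = s, never meeting m; this is a cycle of length \<open>i\<close>.\<close>

lemma orbit_comp_transpose_cut:
  assumes p: "permutation p" and i: "0 < i" "i < card (orbit p m)" and s: "s = (p ^^ i) m"
  shows "m \<notin> orbit (p \<circ> Transposition.transpose s m) s"
    and "card (orbit (p \<circ> Transposition.transpose s m) s) = i"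
proof -
  let ?q = "p \<circ> Transposition.transpose s m"
  have self: "m \<in> orbit p m" by (rule permutation_self_in_orbit[OF p])
  have inj: "inj_on (\<lambda>n. (p ^^ n) m) {0..<funpow_dist1 p m m}"
    by (rule inj_on_funpow_dist1[OF self])
  then have card: "card (orbit p m) = funpow_dist1 p m m"
    by (subst orbit_conv_funpow_dist1[OF self], subst card_image) simp_all
  have neq: "(p ^^ a) m \<noteq> (p ^^ b) m" if "a \<noteq> b" "a < card (orbit p m)" "b < card (orbit p m)" for a b
    using inj_onD[OF inj] that card by auto
  have pow: "(?q ^^ Suc j) s = (p ^^ Suc j) m" if "j < i" for j
    using that
  proof (induction j)
    case (Suc j)
    have "(p ^^ Suc j) m \<noteq> s" "(p ^^ Suc j) m \<noteq> m"
      using neq[of "Suc j" i] neq[of "Suc j" 0] Suc.prems i s by auto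
    then show ?case using Suc by (simp del: funpow.simps add: funpow.simps(2)[of "Suc j"])
  qed simp
  obtain i' where i': "i = Suc i'" using i by (cases i) auto
  have "(?q ^^ i) s = s" using pow[of i'] s i' by simp
  then have "orbit ?q s = {(?q ^^ n) s |n. n < i}"
    by (rule orbit_altdef_bounded) (rule i)
  also have "\<dots> = (\<lambda>j. (p ^^ j) m) ` {1..i}"
  proof (intro equalityI subsetI)
    fix y assume "y \<in> {(?q ^^ n) s |n. n < i}"
    then obtain n where n: "y = (?q ^^ n) s" "n < i" by auto
    show "y \<in> (\<lambda>j. (p ^^ j) m) ` {1..i}"
    proof (cases n)
      case 0
      then show ?thesis using n s i by auto
    next
      case (Suc n')
      then show ?thesis using n pow[of n'] by (intro image_eqI[of _ _ "Suc n'"]) auto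
    qed
  next
    fix y assume "y \<in> (\<lambda>j. (p ^^ j) m) ` {1..i}"
    then obtain j where j: "y = (p ^^ j) m" "1 \<le> j" "j \<le> i" by auto
    show "y \<in> {(?q ^^ n) s |n. n < i}"
    proof (cases "j = i")
      case True
      then show ?thesis using j s i by (auto intro!: exI[of _ 0])
    next
      case False
      then show ?thesis using j pow[of "j - 1"] by (auto intro!: exI[of _ j])
    qed
  qed
  finally have orb: "orbit ?q s = (\<lambda>j. (p ^^ j) m) ` {1..i}" .
  show "m \<notin> orbit ?q s" unfolding orb using neq[of 0] i by auto
  have "inj_on (\<lambda>j. (p ^^ j) m) {1..i}"
    by (rule inj_on_subset[OF inj]) (use i card in auto)
  then show "card (orbit ?q s) = i" unfolding orb by (subst card_image) simp_all
qed

text \<open>Parametrises the points s for which (s m) cuts the cycle of m. By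
  \<open>orbit_comp_transpose_cut\<close> the parameter is the length of the piece containing
  s.\<close>

lemma bij_betw_funpow_orbit:
  assumes "permutation p"
  shows "bij_betw (\<lambda>i. (p ^^ i) m) {1..card (orbit p m) - 1} (orbit p m - {m})"
proof -
  have self: "m \<in> orbit p m" by (rule permutation_self_in_orbit[OF assms])
  define N where "N = funpow_dist1 p m m"
  have "inj_on (\<lambda>n. (p ^^ n) m) {0..<N}"
    unfolding N_def by (rule inj_on_funpow_dist1[OF self])
  moreover have "orbit p m = (\<lambda>n. (p ^^ n) m) ` {0..<N}"
    unfolding N_def by (rule orbit_conv_funpow_dist1[OF self])
  ultimately have bij: "bij_betw (\<lambda>n. (p ^^ n) m) {0..<N} (orbit p m)"
    unfolding bij_betw_def by metis
  have N: "card (orbit p m) = N"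
    using bij_betw_same_card[OF bij] by simp
  have "bij_betw (\<lambda>n. (p ^^ n) m) {0} {m}" by (rule bij_betw_singletonI) simp
  then have "bij_betw (\<lambda>n. (p ^^ n) m) ({0..<N} - {0}) (orbit p m - {m})"
    by (rule bij_betw_DiffI[OF bij]) (use self in \<open>auto simp: N_def\<close>)
  moreover have "{0..<N} - {0} = {1..N - 1}" by auto
  ultimately show ?thesis unfolding N by metis
qed

section \<open>The set of cycles and its change under a transposition\<close>

text \<open>The set is an explicit argument because one permutation is studied on several sets, in
  particular on both sides of a cut.\<close>

definition cycles :: "'a set \<Rightarrow> ('a \<Rightarrow> 'a) \<Rightarrow> 'a set set" where
  "cycles A p = orbit p ` A"

lemma finite_cycles [simp]: "finite A \<Longrightarrow> finite (cycles A p)"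
  by (simp add: cycles_def)

lemma cycles_subset:
  assumes "p ` A \<subseteq> A" "C \<in> cycles A p"
  shows "C \<subseteq> A"
  using assms orbit_subset_invariant[of _ A p] unfolding cycles_def by auto

lemma cycles_eq_orbit:
  assumes "permutation p" "C \<in> cycles A p" "x \<in> C"
  shows "C = orbit p x"
  using assms orbit_eq_of_mem[OF assms(1)] unfolding cycles_def by auto

lemma cycles_disjoint:
  assumes "permutation p" "C \<in> cycles A p" "D \<in> cycles B p" "C \<noteq> D"
  shows "C \<inter> D = {}"
  using assms(4) cycles_eq_orbit[OF assms(1,2)] cycles_eq_orbit[OF assms(1,3)] by auto

lemma Union_cycles:
  assumes "permutation p" "p ` A \<subseteq> A"
  shows "\<Union> (cycles A p) = A"
proof
  show "\<Union> (cycles A p) \<subseteq> A" using cycles_subset[OF assms(2)] by auto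
  show "A \<subseteq> \<Union> (cycles A p)"
    using permutation_self_in_orbit[OF assms(1)] by (auto simp: cycles_def)
qed

lemma cycles_Union:
  assumes "permutation p" "X \<subseteq> cycles A p"
  shows "cycles (\<Union> X) p = X"
proof
  show "cycles (\<Union> X) p \<subseteq> X"
  proof
    fix C assume "C \<in> cycles (\<Union> X) p"
    then obtain x D where "C = orbit p x" "x \<in> D" "D \<in> X" by (auto simp: cycles_def)
    then show "C \<in> X" using cycles_eq_orbit[OF assms(1), of D A x] assms(2) by auto
  qed
  show "X \<subseteq> cycles (\<Union> X) p"
  proof
    fix C assume "C \<in> X"
    then obtain x where "C = orbit p x" using assms by (auto simp: cycles_def)
    then show "C \<in> cycles (\<Union> X) p"
      using \<open>C \<in> X\<close> permutation_self_in_orbit[OF assms(1)] by (auto simp: cycles_def)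
  qed
qed

lemma Union_cycles_invariant:
  assumes "X \<subseteq> cycles A p"
  shows "p ` \<Union> X \<subseteq> \<Union> X"
proof clarify
  fix x C assume x: "x \<in> C" and C: "C \<in> X"
  then obtain y where "C = orbit p y" using assms by (auto simp: cycles_def)
  then have "p x \<in> C" using x by (auto intro: orbit.step)
  then show "p x \<in> \<Union> X" using C by auto
qed

lemma sum_card_cycles:
  assumes "permutation p" "p ` A \<subseteq> A" "finite A"
  shows "sum card (cycles A p) = card A"
proof -
  have "card (\<Union> (cycles A p)) = sum card (cycles A p)"
  proof (rule card_Union_disjoint)
    show "disjoint (cycles A p)"
      using cycles_disjoint[OF assms(1)] unfolding disjoint_def by auto
    show "finite C" if "C \<in> cycles A p" for C
      using cycles_subset[OF assms(2) that] assms(3) finite_subset by auto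
  qed
  then show ?thesis using assms by (simp add: Union_cycles)
qed

lemma card_orbit_pos: "permutation p \<Longrightarrow> card (orbit p x) > 0"
  using permutation_self_in_orbit[of p x] finite_orbit[of x p] by (auto simp: card_gt_0_iff)

lemma cycles_comp_transpose_join:
  assumes p: "permutation p" and A: "s \<in> A" "m \<in> A" and s: "s \<notin> orbit p m"
  defines "q \<equiv> p \<circ> Transposition.transpose s m"
  shows "cycles A q - {orbit q m} = cycles A p - {orbit p m, orbit p s}"
proof -
  have q: "permutation q" unfolding q_def by (rule permutation_comp_transpose[OF p])
  have join: "orbit q m = orbit p m \<union> orbit p s"
    unfolding q_def by (rule orbit_comp_transpose_join(1)[OF p s])
  have other: "orbit q x = orbit p x" if "x \<notin> orbit q m" for x
    using that unfolding join unfolding q_def by (intro orbit_comp_transpose_join(2)[OF p s]) auto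
  have "orbit q x \<noteq> orbit q m \<longleftrightarrow> x \<notin> orbit q m" for x
    using orbit_eq_of_mem[OF q, of x m] permutation_self_in_orbit[OF q, of x] by auto
  moreover have "orbit p x \<noteq> orbit p m \<and> orbit p x \<noteq> orbit p s \<longleftrightarrow> x \<notin> orbit q m" for x
    unfolding join using orbit_eq_of_mem[OF p, of x m] orbit_eq_of_mem[OF p, of x s]
      permutation_self_in_orbit[OF p, of x] by auto
  moreover have "cycles A q - {orbit q m} = orbit q ` {x \<in> A. orbit q x \<noteq> orbit q m}"
    "cycles A p - {orbit p m, orbit p s} = orbit p ` {x \<in> A. orbit p x \<noteq> orbit p m \<and> orbit p x \<noteq> orbit p s}"
    by (auto simp: cycles_def)
  ultimately show ?thesis using other by (auto intro!: image_cong)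
qed

lemma card_cycles_comp_transpose_join:
  assumes p: "permutation p" and A: "s \<in> A" "m \<in> A" "finite A" and s: "s \<notin> orbit p m"
  shows "card (cycles A p) = Suc (card (cycles A (p \<circ> Transposition.transpose s m)))"
proof -
  define q where "q = p \<circ> Transposition.transpose s m"
  have mem: "orbit p m \<in> cycles A p" "orbit p s \<in> cycles A p" "orbit q m \<in> cycles A q"
    using A by (auto simp: cycles_def)
  have "orbit p m \<noteq> orbit p s" using s permutation_self_in_orbit[OF p, of s] by auto
  then have "card (cycles A p) = Suc (Suc (card (cycles A p - {orbit p m} - {orbit p s})))"
    using mem A card.remove[of "cycles A p" "orbit p m"] card.remove[of "cycles A p - {orbit p m}" "orbit p s"]
    by auto
  moreover have "card (cycles A q) = Suc (card (cycles A q - {orbit q m}))"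
    using mem A by (intro card.remove) simp_all
  moreover have "cycles A q - {orbit q m} = cycles A p - {orbit p m} - {orbit p s}"
    using cycles_comp_transpose_join[OF p A(1,2) s] unfolding q_def by auto
  ultimately show ?thesis unfolding q_def by simp
qed

section \<open>Monotone transitive factorizations of a fixed permutation\<close>

text \<open>Transpositions are kept as pairs, with the larger entry second as soon as they lie in
  \<open>edges\<close>. Monotonicity then is sortedness of the second entries, and transitivity is
  connectedness of a graph.\<close>

fun perm_of :: "('a \<times> 'a) list \<Rightarrow> 'a \<Rightarrow> 'a" where
  "perm_of [] = id"
| "perm_of (e # L) = Transposition.transpose (fst e) (snd e) \<circ> perm_of L"

lemma perm_of_append: "perm_of (L @ M) = perm_of L \<circ> perm_of M"
  by (induction L) (simp_all add: comp_assoc)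

definition edges :: "'a::linorder set \<Rightarrow> ('a \<times> 'a) set" where
  "edges A = {(s, t). s \<in> A \<and> t \<in> A \<and> s < t}"

text \<open>Within the vertex set, the closed sets are the unions of connected components of the
  graph with edge list \<open>L\<close>, isolated points included.\<close>

definition closed_under :: "('a \<times> 'a) list \<Rightarrow> 'a set \<Rightarrow> bool" where
  "closed_under L B \<longleftrightarrow> (\<forall>e\<in>set L. fst e \<in> B \<longleftrightarrow> snd e \<in> B)"

definition connects :: "('a \<times> 'a) list \<Rightarrow> 'a set \<Rightarrow> bool" where
  "connects L A \<longleftrightarrow> (\<forall>B\<subseteq>A. closed_under L B \<longrightarrow> B = {} \<or> B = A)"

text \<open>The product is compared with \<open>p\<close> on \<open>A\<close> only, so the same
  \<open>p\<close> can be factored on an invariant subset without first being restricted.\<close>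

definition factorizations :: "'a::linorder set \<Rightarrow> ('a \<Rightarrow> 'a) \<Rightarrow> nat \<Rightarrow> ('a \<times> 'a) list set" where
  "factorizations A p r = {L. length L = r \<and> set L \<subseteq> edges A \<and> sorted (map snd L)
     \<and> (\<forall>x\<in>A. perm_of L x = p x) \<and> connects L A}"

text \<open>The test uses the larger entry, which is the sort key. For an edge inside
  \<open>B\<close> or inside the complement it decides on which side the whole edge lies.\<close>

definition restrict_edges :: "'a set \<Rightarrow> ('a \<times> 'a) list \<Rightarrow> ('a \<times> 'a) list" where
  "restrict_edges B L = filter (\<lambda>e. snd e \<in> B) L"

text \<open>For a proper nonempty subset \<open>B\<close> of \<open>A\<close>, these are the
  monotone lists whose graph has exactly the components \<open>B\<close> and A - B.\<close>

definition split_factorizations :: "'a::linorder set \<Rightarrow> 'a set \<Rightarrow> ('a \<Rightarrow> 'a) \<Rightarrow> nat \<Rightarrow> ('a \<times> 'a) list set" where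
  "split_factorizations A B p r = {L. length L = r \<and> set L \<subseteq> edges B \<union> edges (A - B)
     \<and> sorted (map snd L) \<and> (\<forall>x\<in>A. perm_of L x = p x)
     \<and> connects (restrict_edges B L) B \<and> connects (restrict_edges (A - B) L) (A - B)}"

text \<open>Transpositions inside \<open>C\<close> fix every point of \<open>B\<close>, and those
  inside \<open>B\<close> keep the point in \<open>B\<close>.\<close>

lemma perm_of_restrict_edges:
  assumes "set L \<subseteq> edges B \<union> edges C" "B \<inter> C = {}" "x \<in> B"
  shows "perm_of L x = perm_of (restrict_edges B L) x \<and> perm_of L x \<in> B"
  using assms(1)
proof (induction L)
  case Nil
  then show ?case using assms(3) by (simp add: restrict_edges_def)
next
  case (Cons e L)
  have IH: "perm_of L x = perm_of (restrict_edges B L) x" "perm_of L x \<in> B"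
    using Cons by auto
  show ?case
  proof (cases "snd e \<in> B")
    case True
    then have "fst e \<in> B" using Cons.prems assms(2) by (auto simp: edges_def)
    then show ?thesis using IH True
      by (auto simp: restrict_edges_def Transposition.transpose_def)
  next
    case False
    then have "fst e \<notin> B" using Cons.prems assms(2) by (auto simp: edges_def)
    then have "Transposition.transpose (fst e) (snd e) (perm_of L x) = perm_of L x"
      using False IH(2) by (intro transpose_apply_other) auto
    then show ?thesis using IH False by (simp add: restrict_edges_def)
  qed
qed

lemma perm_of_mem:
  assumes "set L \<subseteq> edges B" "x \<in> B"
  shows "perm_of L x \<in> B"
  using perm_of_restrict_edges[of L B "{}" x] assms by auto

lemma finite_factorizations [simp]:
  assumes "finite A"
  shows "finite (factorizations A p r)"
proof -
  have "finite (edges A)"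
    by (rule finite_subset[of _ "A \<times> A"]) (use assms in \<open>auto simp: edges_def\<close>)
  then have "finite {L. set L \<subseteq> edges A \<and> length L = r}" by (rule finite_lists_length_eq)
  then show ?thesis by (rule finite_subset[rotated]) (auto simp: factorizations_def)
qed

lemma factorizations_nonempty_invariant:
  assumes "factorizations A p r \<noteq> {}"
  shows "p ` A \<subseteq> A"
proof
  fix y assume "y \<in> p ` A"
  then obtain x where x: "x \<in> A" "y = p x" by auto
  obtain L where "L \<in> factorizations A p r" using assms by auto
  then have "perm_of L x = p x" "set L \<subseteq> edges A" using x by (auto simp: factorizations_def)
  then show "y \<in> A" using perm_of_mem[of L A x] x by simp
qed

section \<open>Interleaving two monotone lists on complementary sets\<close>

text \<open>Edges with equal larger entry lie on the same side. So the order between the sides is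
  forced by the keys, and within a side it is kept because \<open>sort_key\<close> is
  stable.\<close>

lemma sort_key_restrict_edges:
  assumes "sorted (map snd L)" "set L \<subseteq> edges B \<union> edges C" "B \<inter> C = {}"
  shows "sort_key snd (restrict_edges B L @ restrict_edges C L) = L"
proof (rule properties_for_sort_key)
  have C: "restrict_edges C L = filter (\<lambda>e. \<not> snd e \<in> B) L"
    unfolding restrict_edges_def
    by (rule filter_cong) (use assms(2,3) in \<open>auto simp: edges_def\<close>)
  show "mset L = mset (restrict_edges B L @ restrict_edges C L)"
    unfolding C by (simp add: restrict_edges_def)
  show "filter (\<lambda>x. snd k = snd x) L = filter (\<lambda>x. snd k = snd x) (restrict_edges B L @ restrict_edges C L)"
    if "k \<in> set L" for k
  proof (cases "snd k \<in> B")
    case True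
    then have "filter (\<lambda>x. snd k = snd x) (restrict_edges B L) = filter (\<lambda>x. snd k = snd x) L"
      unfolding restrict_edges_def filter_filter by (intro filter_cong) auto
    moreover have "filter (\<lambda>x. snd k = snd x) (restrict_edges C L) = []"
      unfolding C using True by (auto simp: filter_empty_conv)
    ultimately show ?thesis by simp
  next
    case False
    then have "filter (\<lambda>x. snd k = snd x) (restrict_edges C L) = filter (\<lambda>x. snd k = snd x) L"
      unfolding C filter_filter by (intro filter_cong) auto
    moreover have "filter (\<lambda>x. snd k = snd x) (restrict_edges B L) = []"
      unfolding restrict_edges_def using False by (auto simp: filter_empty_conv)
    ultimately show ?thesis by simp
  qed
  show "sorted (map snd L)" by (rule assms(1))
qed

lemma restrict_edges_in_factorizations:
  assumes "set L \<subseteq> edges B \<union> edges C" "B \<inter> C = {}" "sorted (map snd L)"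
    and "\<forall>x\<in>B. perm_of L x = p x" "connects (restrict_edges B L) B"
  shows "restrict_edges B L \<in> factorizations B p (length (restrict_edges B L))"
proof -
  have "set (restrict_edges B L) \<subseteq> edges B"
    using assms(1,2) by (auto simp: restrict_edges_def edges_def)
  moreover have "sorted (map snd (restrict_edges B L))"
    unfolding restrict_edges_def by (rule sorted_filter[OF assms(3)])
  moreover have "perm_of (restrict_edges B L) x = p x" if "x \<in> B" for x
    using perm_of_restrict_edges[OF assms(1,2) that] assms(4) that by simp
  ultimately show ?thesis using assms(5) by (simp add: factorizations_def)
qed

lemma split_factorizationsD:
  assumes "L \<in> split_factorizations A B p r" "B \<subseteq> A"
  obtains i where "i \<le> r" "restrict_edges B L \<in> factorizations B p i"
    "restrict_edges (A - B) L \<in> factorizations (A - B) p (r - i)"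
proof -
  have set: "set L \<subseteq> edges B \<union> edges (A - B)" using assms(1) by (simp add: split_factorizations_def)
  have "restrict_edges (A - B) L = filter (\<lambda>e. \<not> snd e \<in> B) L"
    unfolding restrict_edges_def by (rule filter_cong) (use set in \<open>auto simp: edges_def\<close>)
  then have len: "length (restrict_edges B L) + length (restrict_edges (A - B) L) = r"
    using assms(1) by (simp add: restrict_edges_def sum_length_filter_compl split_factorizations_def)
  have "restrict_edges B L \<in> factorizations B p (length (restrict_edges B L))"
    by (rule restrict_edges_in_factorizations[where C = "A - B"])
      (use assms in \<open>auto simp: split_factorizations_def\<close>)
  moreover have "restrict_edges (A - B) L \<in> factorizations (A - B) p (length (restrict_edges (A - B) L))"
    by (rule restrict_edges_in_factorizations[where C = B])
      (use assms in \<open>auto simp: split_factorizations_def\<close>)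
  moreover have "length (restrict_edges B L) \<le> r"
    "length (restrict_edges (A - B) L) = r - length (restrict_edges B L)" using len by auto
  ultimately show thesis using that by simp
qed

text \<open>Restricting to the two sides and merging by a stable sort are mutually inverse;
  \<open>i\<close> is the number of edges inside \<open>B\<close>.\<close>

lemma card_split_factorizations:
  assumes "finite A" "B \<subseteq> A"
  shows "card (split_factorizations A B p r)
    = (\<Sum>i\<le>r. card (factorizations B p i) * card (factorizations (A - B) p (r - i)))"
proof -
  let ?X = "\<lambda>i. factorizations B p i \<times> factorizations (A - B) p (r - i)"
  let ?f = "\<lambda>L. (restrict_edges B L, restrict_edges (A - B) L)"
  let ?g = "\<lambda>(L, M). sort_key snd (L @ M)"
  have "bij_betw ?f (split_factorizations A B p r) (\<Union>i\<le>r. ?X i)"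
  proof (rule bij_betw_byWitness[where f' = ?g])
    show "\<forall>L\<in>split_factorizations A B p r. ?g (?f L) = L"
      by (auto simp: split_factorizations_def intro!: sort_key_restrict_edges)
    have inv: "restrict_edges B (sort_key snd (L @ M)) = L \<and> restrict_edges (A - B) (sort_key snd (L @ M)) = M"
      if "set L \<subseteq> edges B" "set M \<subseteq> edges (A - B)" "sorted (map snd L)" "sorted (map snd M)" for L M
    proof -
      have "filter (\<lambda>e. snd e \<in> B) L = L" "filter (\<lambda>e. snd e \<in> B) M = []"
        "filter (\<lambda>e. snd e \<in> A - B) L = []" "filter (\<lambda>e. snd e \<in> A - B) M = M"
        using that(1,2) by (auto simp: filter_id_conv filter_empty_conv edges_def)
      then show ?thesis
        using that(3,4) by (simp add: restrict_edges_def filter_sort sort_key_id_if_sorted del: Diff_iff)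
    qed
    then show "\<forall>y\<in>\<Union>i\<le>r. ?X i. ?f (?g y) = y"
      by (auto simp: factorizations_def)
    show "?f ` split_factorizations A B p r \<subseteq> (\<Union>i\<le>r. ?X i)"
    proof
      fix y assume "y \<in> ?f ` split_factorizations A B p r"
      then obtain L where L: "L \<in> split_factorizations A B p r" and y: "y = ?f L" by auto
      obtain i where "i \<le> r" "restrict_edges B L \<in> factorizations B p i"
        "restrict_edges (A - B) L \<in> factorizations (A - B) p (r - i)"
        using L assms(2) by (rule split_factorizationsD)
      then show "y \<in> (\<Union>i\<le>r. ?X i)" unfolding y by auto
    qed
    show "?g ` (\<Union>i\<le>r. ?X i) \<subseteq> split_factorizations A B p r"
    proof clarify
      fix i L M assume i: "i \<le> r" and L: "L \<in> factorizations B p i" and M: "M \<in> factorizations (A - B) p (r - i)"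
      let ?K = "sort_key snd (L @ M)"
      have K: "restrict_edges B ?K = L \<and> restrict_edges (A - B) ?K = M"
        using L M by (intro inv) (auto simp: factorizations_def)
      have set: "set ?K \<subseteq> edges B \<union> edges (A - B)"
        using L M by (auto simp: factorizations_def)
      have "perm_of ?K x = p x" if "x \<in> A" for x
      proof (cases "x \<in> B")
        case True
        then show ?thesis
          using perm_of_restrict_edges[OF set, of x] K L by (auto simp: factorizations_def)
      next
        case False
        then show ?thesis
          using perm_of_restrict_edges[of ?K "A - B" B x] set that K M
          by (auto simp: factorizations_def)
      qed
      moreover have "length ?K = r" using i L M by (simp add: factorizations_def)
      ultimately show "?K \<in> split_factorizations A B p r"
        using set K L M by (simp add: split_factorizations_def factorizations_def)
    qed
  qed
  then have "card (split_factorizations A B p r) = card (\<Union>i\<le>r. ?X i)"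
    by (rule bij_betw_same_card)
  also have "\<dots> = (\<Sum>i\<le>r. card (?X i))"
  proof (rule card_UN_disjoint)
    show "\<forall>i\<in>{..r}. finite (?X i)"
      using assms(1) finite_subset[OF assms(2,1)] by (intro ballI finite_cartesian_product) simp_all
    show "\<forall>i\<in>{..r}. \<forall>j\<in>{..r}. i \<noteq> j \<longrightarrow> ?X i \<inter> ?X j = {}"
      by (auto simp: factorizations_def)
  qed simp
  finally show ?thesis by (simp add: card_cartesian_product)
qed

section \<open>Removal of the last transposition\<close>

text \<open>Connectedness forces an edge at m, necessarily as larger entry, and monotonicity then
  forces the last edge to end in m. Without it the graph is connected or has two components
  separating its ends. \<open>B\<close> is the component of s, and requiring m to lie outside
  \<open>B\<close> prevents counting the pair of components twice.\<close>

lemma factorizations_Suc: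
  assumes "finite A" "card A \<ge> 2" "m = Max A"
  shows "factorizations A p (Suc r) = (\<Union>s\<in>A - {m}. (\<lambda>L. L @ [(s, m)]) `
     (factorizations A (p \<circ> Transposition.transpose s m) r
      \<union> (\<Union>B\<in>{B. B \<subseteq> A - {m} \<and> s \<in> B}. split_factorizations A B (p \<circ> Transposition.transpose s m) r)))"
    (is "_ = (\<Union>s\<in>A - {m}. ?add s ` ?R s)")
proof (intro equalityI subsetI)
  have "A \<noteq> {}" using assms(2) by auto
  then have m: "m \<in> A" and le_m: "x \<le> m" if "x \<in> A" for x
    using assms(1,3) that by auto
  have mA: "m \<in> A" using m \<open>A \<noteq> {}\<close> by auto
  {
    fix K assume K: "K \<in> factorizations A p (Suc r)"
    have conn: "C = {} \<or> C = A" if "C \<subseteq> A" "closed_under K C" for C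
      using K that by (auto simp: factorizations_def connects_def)
    have "A \<noteq> {m}" using assms(2) by auto
    then have "\<not> closed_under K {m}" using conn[of "{m}"] mA by auto
    then obtain e where e: "e \<in> set K" "fst e = m \<or> snd e = m"
      by (auto simp: closed_under_def)
    have "snd e = m"
      using e K le_m[of "snd e"] by (force simp: factorizations_def edges_def)
    obtain L s t where L: "K = L @ [(s, t)]"
      using K by (cases K rule: rev_cases) (auto simp: factorizations_def)
    have st: "s \<in> A" "t \<in> A" "s < t" using K L by (auto simp: factorizations_def edges_def)
    have "m \<le> t"
      using e \<open>snd e = m\<close> K L by (auto simp: factorizations_def sorted_append)
    then have t: "t = m" using le_m[OF st(2)] by simp
    have sm: "s \<in> A - {m}" using st t by auto
    have setL: "set L \<subseteq> edges A" and len: "length L = r" and sort: "sorted (map snd L)"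
      using K L by (auto simp: factorizations_def sorted_append)
    have perm: "perm_of L x = (p \<circ> Transposition.transpose s m) x" if "x \<in> A" for x
    proof -
      have "Transposition.transpose s m x \<in> A"
        using that st mA by (auto simp: Transposition.transpose_def)
      then have "perm_of K (Transposition.transpose s m x) = p (Transposition.transpose s m x)"
        using K by (auto simp: factorizations_def)
      then show ?thesis by (simp add: L perm_of_append t)
    qed
    have closedK: "closed_under K C" if "closed_under L C" "s \<in> C \<longleftrightarrow> m \<in> C" for C
      using that by (auto simp: closed_under_def L t)
    have "L \<in> ?R s"
    proof (cases "connects L A")
      case True
      then show ?thesis using setL len sort perm by (auto simp: factorizations_def)
    next
      case False
      then obtain B' where B': "B' \<subseteq> A" "closed_under L B'" "B' \<noteq> {}" "B' \<noteq> A"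
        by (auto simp: connects_def)
      have sep: "(s \<in> B') \<noteq> (m \<in> B')" using conn[OF B'(1)] closedK[OF B'(2)] B'(3,4) by auto
      \<comment> \<open>The closed set found contains exactly one end of the removed edge;
        \<open>B\<close> is the side of s.\<close>
      define B where "B = (if s \<in> B' then B' else A - B')"
      have closed_diff: "closed_under L (D - C)" if "closed_under L C" "closed_under L D" for C D
        using that by (auto simp: closed_under_def)
      have closedA: "closed_under L A" using setL by (auto simp: closed_under_def edges_def)
      have B: "B \<subseteq> A" "closed_under L B" "s \<in> B" "m \<notin> B"
        using B' sep closed_diff[OF B'(2) closedA] st mA by (auto simp: B_def)
      have setB: "set L \<subseteq> edges B \<union> edges (A - B)"
        using setL B(2) by (fastforce simp: closed_under_def edges_def)
      have closed_restrict: "closed_under L C"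
        if "C \<subseteq> D" "closed_under (restrict_edges D L) C" "closed_under L D" for C D
        using that unfolding closed_under_def restrict_edges_def by auto
      \<comment> \<open>A closed part of \<open>B\<close> avoiding s stays closed when (s, m) is put
        back, because m is not in \<open>B\<close>; connectedness of \<open>K\<close> then makes it
        empty. For a part containing s the same is applied to its complement in \<open>B\<close>.
        The other side is analogous, with m in place of s.\<close>
      have "connects (restrict_edges B L) B"
        unfolding connects_def
      proof (intro allI impI)
        fix C assume C: "C \<subseteq> B" "closed_under (restrict_edges B L) C"
        then have CL: "closed_under L C" using B(2) by (rule closed_restrict)
        show "C = {} \<or> C = B"
        proof (cases "s \<in> C")
          case True
          then have "closed_under K (B - C)"
            using B(4) by (intro closedK closed_diff[OF CL B(2)]) auto
          then have "B - C = {} \<or> B - C = A" using B(1) by (intro conn) auto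
          then show ?thesis using C(1) B(4) mA by auto
        next
          case False
          then have "closed_under K C" using C(1) B(4) by (intro closedK[OF CL]) auto
          then have "C = {} \<or> C = A" using C(1) B(1) by (intro conn) auto
          then show ?thesis using C(1) B(4) mA by auto
        qed
      qed
      moreover have "connects (restrict_edges (A - B) L) (A - B)"
        unfolding connects_def
      proof (intro allI impI)
        fix C assume C: "C \<subseteq> A - B" "closed_under (restrict_edges (A - B) L) C"
        then have CL: "closed_under L C" using closed_diff[OF B(2) closedA] by (rule closed_restrict)
        show "C = {} \<or> C = A - B"
        proof (cases "m \<in> C")
          case True
          then have "closed_under K (A - B - C)"
            using B(3) by (intro closedK closed_diff[OF CL] closed_diff[OF B(2) closedA]) auto
          then have "A - B - C = {} \<or> A - B - C = A" by (intro conn) auto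
          then show ?thesis using C(1) B(3) st by auto
        next
          case False
          then have "closed_under K C" using C(1) B(3) by (intro closedK[OF CL]) auto
          then have "C = {} \<or> C = A" using C(1) by (intro conn) auto
          then show ?thesis using C(1) B(3) st by auto
        qed
      qed
      ultimately have "L \<in> split_factorizations A B (p \<circ> Transposition.transpose s m) r"
        unfolding split_factorizations_def using setB len sort perm by blast
      then show ?thesis using B by auto
    qed
    then show "K \<in> (\<Union>s\<in>A - {m}. ?add s ` ?R s)" using sm L t by blast
  next
    fix K assume "K \<in> (\<Union>s\<in>A - {m}. ?add s ` ?R s)"
    then obtain s L where s: "s \<in> A - {m}" and L: "L \<in> ?R s" and K: "K = L @ [(s, m)]" by blast
    have sA: "s \<in> A" "s < m" using s le_m[of s] by auto
    have *: "length L = r" "set L \<subseteq> edges A" "sorted (map snd L)"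
      "\<forall>x\<in>A. perm_of L x = (p \<circ> Transposition.transpose s m) x"
      using L by (auto simp: factorizations_def split_factorizations_def edges_def)
    have "sorted (map snd K)"
      using * le_m by (auto simp: K sorted_append edges_def)
    moreover have "perm_of K x = p x" if "x \<in> A" for x
    proof -
      have "Transposition.transpose s m x \<in> A"
        using that sA mA by (auto simp: Transposition.transpose_def)
      then show ?thesis using *(4) by (simp add: K perm_of_append)
    qed
    moreover have "set K \<subseteq> edges A" using * sA mA by (auto simp: K edges_def)
    moreover have "connects K A"
      unfolding connects_def
    proof (intro allI impI)
      fix C assume C: "C \<subseteq> A" "closed_under K C"
      then have CL: "closed_under L C" and sm: "s \<in> C \<longleftrightarrow> m \<in> C"
        by (auto simp: K closed_under_def)
      show "C = {} \<or> C = A"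
      proof (cases "L \<in> factorizations A (p \<circ> Transposition.transpose s m) r")
        case True
        then show ?thesis using C(1) CL by (auto simp: factorizations_def connects_def)
      next
        case False
        then obtain B where B: "B \<subseteq> A - {m}" "s \<in> B"
          and LB: "L \<in> split_factorizations A B (p \<circ> Transposition.transpose s m) r"
          using L by auto
        have setB: "set L \<subseteq> edges B \<union> edges (A - B)"
          and connB: "connects (restrict_edges B L) B"
          and connAB: "connects (restrict_edges (A - B) L) (A - B)"
          using LB by (simp_all add: split_factorizations_def)
        have "closed_under (restrict_edges B L) (C \<inter> B)"
          using CL setB by (fastforce simp: closed_under_def restrict_edges_def edges_def)
        then have 1: "C \<inter> B = {} \<or> C \<inter> B = B" using connB by (simp add: connects_def)
        have "closed_under (restrict_edges (A - B) L) (C \<inter> (A - B))"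
          using CL setB by (fastforce simp: closed_under_def restrict_edges_def edges_def)
        then have 2: "C \<inter> (A - B) = {} \<or> C \<inter> (A - B) = A - B" using connAB by (simp add: connects_def)
        show ?thesis using 1 2 sm B mA C(1) by blast
      qed
    qed
    ultimately show "K \<in> factorizations A p (Suc r)"
      using *(1) by (simp add: factorizations_def K)
  }
qed

text \<open>All unions in \<open>factorizations_Suc\<close> are disjoint: s is read off the last
  edge, a connected list does not split, and \<open>B\<close> is recovered from the list as the
  component of s.\<close>

lemma card_factorizations_Suc:
  assumes "finite A" "card A \<ge> 2" "m = Max A"
  shows "card (factorizations A p (Suc r)) = (\<Sum>s\<in>A - {m}.
     card (factorizations A (p \<circ> Transposition.transpose s m) r)
      + (\<Sum>B\<in>{B. B \<subseteq> A - {m} \<and> s \<in> B}. \<Sum>i\<le>r. card (factorizations B (p \<circ> Transposition.transpose s m) i)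
          * card (factorizations (A - B) (p \<circ> Transposition.transpose s m) (r - i))))"
proof -
  let ?q = "\<lambda>s. p \<circ> Transposition.transpose s m"
  let ?Bs = "\<lambda>s. {B. B \<subseteq> A - {m} \<and> s \<in> B}"
  let ?S = "\<lambda>s. \<Union>B\<in>?Bs s. split_factorizations A B (?q s) r"
  have "A \<noteq> {}" using assms(2) by auto
  then have mA: "m \<in> A" using assms(1,3) by auto
  have finB: "finite (?Bs s)" for s using assms(1) by auto
  have fin_split: "finite (split_factorizations A B q r)" if "B \<subseteq> A" for B q
  proof -
    have "finite (edges A)"
      by (rule finite_subset[of _ "A \<times> A"]) (use assms in \<open>auto simp: edges_def\<close>)
    then have "finite {L. set L \<subseteq> edges A \<and> length L = r}" by (rule finite_lists_length_eq)
    moreover have "edges B \<union> edges (A - B) \<subseteq> edges A" using that by (auto simp: edges_def)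
    ultimately show ?thesis
      by (elim finite_subset[rotated]) (auto simp: split_factorizations_def)
  qed
  have closed: "closed_under L B" if "L \<in> split_factorizations A B q r" for L B q
    using that by (fastforce simp: split_factorizations_def closed_under_def edges_def)
  have disjB: "split_factorizations A B (?q s) r \<inter> split_factorizations A D (?q s) r = {}"
    if "B \<in> ?Bs s" "D \<in> ?Bs s" "B \<noteq> D" for s B D
  proof (rule ccontr)
    assume "\<not> ?thesis"
    then obtain L where L: "L \<in> split_factorizations A B (?q s) r" "L \<in> split_factorizations A D (?q s) r"
      by blast
    have *: "X \<subseteq> Y" if X: "L \<in> split_factorizations A X (?q s) r" and Y: "L \<in> split_factorizations A Y (?q s) r"
      and "s \<in> X" "s \<in> Y" for X Y
    proof -
      have "closed_under (restrict_edges X L) (X \<inter> Y)"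
        using closed[OF X] closed[OF Y] by (auto simp: closed_under_def restrict_edges_def)
      then have "X \<inter> Y = {} \<or> X \<inter> Y = X"
        using X by (auto simp: split_factorizations_def connects_def)
      then show ?thesis using that by auto
    qed
    show False using *[OF L] *[OF L(2,1)] that by auto
  qed
  have disjF: "factorizations A (?q s) r \<inter> ?S s = {}" for s
  proof (rule ccontr)
    assume "\<not> ?thesis"
    then obtain L B where L: "L \<in> factorizations A (?q s) r" "L \<in> split_factorizations A B (?q s) r"
      and B: "B \<subseteq> A - {m}" "s \<in> B" by blast
    have "B = {} \<or> B = A"
      using closed[OF L(2)] L(1) B by (auto simp: factorizations_def connects_def)
    then show False using B mA by auto
  qed
  have finS: "finite (?S s)" for s using finB fin_split by blast
  have cardS: "card (?S s) = (\<Sum>B\<in>?Bs s. card (split_factorizations A B (?q s) r))" for s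
  proof (rule card_UN_disjoint[OF finB])
    show "\<forall>B\<in>?Bs s. finite (split_factorizations A B (?q s) r)"
      by (intro ballI fin_split) auto
    show "\<forall>B\<in>?Bs s. \<forall>D\<in>?Bs s. B \<noteq> D \<longrightarrow>
        split_factorizations A B (?q s) r \<inter> split_factorizations A D (?q s) r = {}"
      using disjB by simp
  qed
  have "card (factorizations A p (Suc r))
      = (\<Sum>s\<in>A - {m}. card ((\<lambda>L. L @ [(s, m)]) ` (factorizations A (?q s) r \<union> ?S s)))"
    unfolding factorizations_Suc[OF assms]
    by (rule card_UN_disjoint) (use assms(1) finS in auto)
  also have "\<dots> = (\<Sum>s\<in>A - {m}. card (factorizations A (?q s) r \<union> ?S s))"
    by (intro sum.cong refl card_image) (simp add: inj_on_def)
  also have "\<dots> = (\<Sum>s\<in>A - {m}. card (factorizations A (?q s) r) + card (?S s))"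
    by (intro sum.cong refl card_Un_disjoint finS disjF finite_factorizations assms(1))
  also have "\<dots> = (\<Sum>s\<in>A - {m}. card (factorizations A (?q s) r)
      + (\<Sum>B\<in>?Bs s. card (split_factorizations A B (?q s) r)))"
    by (simp only: cardS)
  also have "\<dots> = (\<Sum>s\<in>A - {m}. card (factorizations A (?q s) r)
      + (\<Sum>B\<in>?Bs s. \<Sum>i\<le>r. card (factorizations B (?q s) i) * card (factorizations (A - B) (?q s) (r - i))))"
    by (intro sum.cong refl arg_cong2[of _ _ _ _ "(+)"] card_split_factorizations assms(1)) auto
  finally show ?thesis .
qed

section \<open>The genus is nonnegative\<close>

lemma transpose_image_subset:
  assumes "p ` A \<subseteq> A" "s \<in> A" "m \<in> A"
  shows "(p \<circ> Transposition.transpose s m) ` A \<subseteq> A"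
  unfolding image_comp[symmetric] using assms by (simp only: transpose_image_eq)

lemma not_in_orbit_comp_transpose:
  assumes p: "permutation p" and s: "s \<in> orbit p m" "s \<noteq> m"
  shows "s \<notin> orbit (p \<circ> Transposition.transpose s m) m"
proof
  let ?q = "p \<circ> Transposition.transpose s m"
  have q: "permutation ?q" by (rule permutation_comp_transpose[OF p])
  obtain i where i: "i \<in> {1..card (orbit p m) - 1}" "s = (p ^^ i) m"
    using bij_betw_imp_surj_on[OF bij_betw_funpow_orbit[OF p, of m]] s by blast
  then have "m \<notin> orbit ?q s"
    by (intro orbit_comp_transpose_cut(1)[OF p]) auto
  moreover assume "s \<in> orbit ?q m"
  then have "orbit ?q s = orbit ?q m" by (rule orbit_eq_of_mem[OF q])
  ultimately show False using permutation_self_in_orbit[OF q, of m] by simp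
qed

lemma card_cycles_comp_transpose_cut:
  assumes p: "permutation p" and A: "s \<in> A" "m \<in> A" "finite A" and s: "s \<in> orbit p m" "s \<noteq> m"
  shows "card (cycles A (p \<circ> Transposition.transpose s m)) = Suc (card (cycles A p))"
  using card_cycles_comp_transpose_join[OF permutation_comp_transpose[OF p] A not_in_orbit_comp_transpose[OF p s]]
  by simp

lemma cycles_singleton:
  assumes "p ` {x} \<subseteq> {x}"
  shows "cycles {x} p = {{x}}"
  using assms orbit_eq_singleton_iff[of p x] by (simp add: cycles_def)

lemma factorizations_0_eq_empty:
  assumes "card A \<ge> 2"
  shows "factorizations A p 0 = {}"
proof (rule ccontr)
  assume "factorizations A p 0 \<noteq> {}"
  then have conn: "connects [] A" by (auto simp: factorizations_def)
  have "A \<noteq> {}" using assms by auto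
  then obtain x where "x \<in> A" by blast
  then have "{x} = A" using conn by (auto simp: connects_def closed_under_def)
  then show False using assms by auto
qed

text \<open>With r = 2g - 2 + (number of cycles) + |A| this says g >= 0. Remove the last
  transposition. If the rest is connected, the number of cycles changed by one and the bound
  persists. If it splits, \<open>q\<close> preserves \<open>B\<close>, so s and m lie in different
  cycles of \<open>q\<close> and \<open>q\<close> has one cycle more than \<open>p\<close>; adding
  the bounds for the two sides gives the claim.\<close>

theorem genus_nonnegative:
  assumes "permutation p" "finite A" "A \<noteq> {}" "factorizations A p r \<noteq> {}"
  shows "card (cycles A p) + card A \<le> r + 2"
  using assms
proof (induction r arbitrary: A p rule: less_induct)
  case (less r)
  note p = less.prems(1) and fin = less.prems(2)
  have inv: "p ` A \<subseteq> A" using less.prems(4) by (rule factorizations_nonempty_invariant)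
  show ?case
  proof (cases "card A \<ge> 2")
    case False
    moreover have "card A > 0" using less.prems(2,3) by (simp add: card_gt_0_iff)
    ultimately have "card A = 1" by simp
    then obtain x where "A = {x}" by (rule card_1_singletonE)
    then show ?thesis using inv cycles_singleton[of p x] by simp
  next
    case True
    then obtain r' where r: "r = Suc r'"
      using less.prems(4) factorizations_0_eq_empty[OF True] by (cases r) auto
    define m where "m = Max A"
    have m: "m \<in> A" using less.prems(2,3) by (simp add: m_def)
    from less.prems(4) obtain s L where s: "s \<in> A" "s \<noteq> m"
      and L: "L \<in> factorizations A (p \<circ> Transposition.transpose s m) r'
        \<union> (\<Union>B\<in>{B. B \<subseteq> A - {m} \<and> s \<in> B}. split_factorizations A B (p \<circ> Transposition.transpose s m) r')"
      unfolding r factorizations_Suc[OF fin True m_def] by blast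
    define q where "q = p \<circ> Transposition.transpose s m"
    have q: "permutation q" unfolding q_def by (rule permutation_comp_transpose[OF p])
    have pq: "p = q \<circ> Transposition.transpose s m" by (simp add: q_def)
    show ?thesis
    proof (cases "L \<in> factorizations A q r'")
      case True
      then have "card (cycles A q) + card A \<le> r' + 2"
        using less.prems(3) by (intro less.IH q fin) (auto simp: r)
      moreover have "card (cycles A p) \<le> Suc (card (cycles A q))"
        using card_cycles_comp_transpose_join[OF p s(1) m fin]
          card_cycles_comp_transpose_cut[OF p s(1) m fin _ s(2)]
        unfolding q_def by (cases "s \<in> orbit p m") auto
      ultimately show ?thesis by (simp add: r)
    next
      case False
      then obtain B where B: "B \<subseteq> A - {m}" "s \<in> B" and LB: "L \<in> split_factorizations A B q r'"
        using L unfolding q_def by blast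
      have BA: "B \<subseteq> A" using B by auto
      obtain i where i: "i \<le> r'" "restrict_edges B L \<in> factorizations B q i"
        "restrict_edges (A - B) L \<in> factorizations (A - B) q (r' - i)"
        using LB BA by (rule split_factorizationsD)
      have finB: "finite B" using fin BA finite_subset by auto
      have 1: "card (cycles B q) + card B \<le> i + 2"
        using i B by (intro less.IH q finB) (auto simp: r)
      have 2: "card (cycles (A - B) q) + card (A - B) \<le> r' - i + 2"
        using i B m fin by (intro less.IH q) (auto simp: r)
      have "cycles A q = cycles B q \<union> cycles (A - B) q"
        using BA by (auto simp: cycles_def)
      then have 3: "card (cycles A q) \<le> card (cycles B q) + card (cycles (A - B) q)"
        using card_Un_le by metis
      have "q ` B \<subseteq> B" using i(2) by (intro factorizations_nonempty_invariant) auto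
      then have "orbit q s \<subseteq> B" by (rule orbit_subset_invariant[OF B(2)])
      then have "m \<notin> orbit q s" using B(1) by auto
      then have "s \<notin> orbit q m"
        using orbit_eq_of_mem[OF q, of s m] permutation_self_in_orbit[OF q, of m] by auto
      then have "card (cycles A q) = Suc (card (cycles A p))"
        unfolding pq using card_cycles_comp_transpose_join[OF q s(1) m fin] by simp
      moreover have "card A = card B + card (A - B)"
        using BA fin card_Diff_subset[OF finB BA] card_mono[OF fin BA] by simp
      ultimately show ?thesis using 1 2 3 i(1) by (simp add: r)
    qed
  qed
qed

section \<open>Counting in genus zero\<close>

text \<open>The factors \<open>card C\<close> come from dividing by the class size d! / (|Aut| prod
  a_i), where the a_i are the cycle lengths.\<close>

definition planar_count :: "'a set \<Rightarrow> ('a \<Rightarrow> 'a) \<Rightarrow> real" where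
  "planar_count A p = (\<Prod>C\<in>cycles A p. real (card C) * central_binomial (card C))
     * rising (2 * real (card A) + 1) (int (card (cycles A p)) - 3)"

text \<open>Separates the cycle of m, on which the recursion acts, from the other cycles.\<close>

lemma planar_count_eq_branch:
  assumes "permutation p" "p ` A \<subseteq> A" "finite A" "m \<in> A"
  shows "planar_count A p
    = (\<Prod>C\<in>cycles A p - {orbit p m}. real (card C) * central_binomial (card C))
      * (central_binomial (card (orbit p m) - 1) * branch card (cycles A p - {orbit p m}) (card (orbit p m)))"
proof -
  have mem: "orbit p m \<in> cycles A p" using assms(4) by (simp add: cycles_def)
  have fin: "finite (cycles A p)" using assms(3) by simp
  have "sum card (cycles A p) = card (orbit p m) + sum card (cycles A p - {orbit p m})"
    using mem fin by (intro sum.remove)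
  then have 1: "card (orbit p m) + sum card (cycles A p - {orbit p m}) = card A"
    using sum_card_cycles[OF assms(1-3)] by simp
  have 2: "int (card (cycles A p - {orbit p m})) - 2 = int (card (cycles A p)) - 3"
    using card.remove[OF fin mem] by simp
  have 3: "(\<Prod>C\<in>cycles A p. real (card C) * central_binomial (card C))
     = real (card (orbit p m)) * central_binomial (card (orbit p m))
       * (\<Prod>C\<in>cycles A p - {orbit p m}. real (card C) * central_binomial (card C))"
    using mem fin by (intro prod.remove)
  have "card (orbit p m) \<ge> 1"
    using card_orbit_pos[OF assms(1), of m] by simp
  then show ?thesis
    using fin by (simp only: planar_count_def 3 branch_eq_rising 1 2 finite_Diff) (simp only: ac_simps)
qed

text \<open>The last hypothesis is genus zero. The summands of
  \<open>card_factorizations_Suc\<close> that survive the genus bound and the invariance of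
  \<open>B\<close> under the product are those of \<open>branch_join_cut\<close>.\<close>

theorem card_factorizations_planar:
  assumes "permutation p" "p ` A \<subseteq> A" "finite A" "A \<noteq> {}" "card (cycles A p) + card A = r + 2"
  shows "real (card (factorizations A p r)) = planar_count A p"
  using assms
proof (induction r arbitrary: A p rule: less_induct)
  case (less r)
  note p = less.prems(1) and inv = less.prems(2) and fin = less.prems(3)
  show ?case
  proof (cases "card A \<ge> 2")
    case False
    moreover have "card A > 0" using less.prems(3,4) by (simp add: card_gt_0_iff)
    ultimately have "card A = 1" by simp
    then obtain x where A: "A = {x}" by (rule card_1_singletonE)
    have cyc: "cycles A p = {{x}}" using inv cycles_singleton[of p x] A by simp
    have orb: "orbit p x = {x}" using cyc by (simp add: A cycles_def)
    have "r = 0" using less.prems(5) cyc by (simp add: A)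
    have "factorizations A p 0 = {[]}"
      using inv by (auto simp: factorizations_def A connects_def)
    \<comment> \<open>The factor 1 * binom(2, 1) = 2 meets \<open>rising 3 (-2)\<close> = 1/2; here
      the value is read off \<open>branch\<close> at the empty set.\<close>
    moreover have "planar_count A p = 1"
      using planar_count_eq_branch[OF p inv fin, of x]
      by (simp add: cyc[unfolded A] orb branch_def rothe_def A)
    ultimately show ?thesis using \<open>r = 0\<close> by simp
  next
    case True
    define m where "m = Max A"
    have m: "m \<in> A" using less.prems(3,4) by (simp add: m_def)
    define O' where "O' = orbit p m"
    define k where "k = card O'"
    define S where "S = cycles A p - {O'}"
    define w where "w C = real (card C) * central_binomial (card C)" for C :: "'a set"
    define F where "F k T = central_binomial (k - 1) * branch card T k" for k and T :: "'a set set"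
    have finS: "finite S" using fin by (simp add: S_def)
    have O': "O' \<in> cycles A p" "O' \<subseteq> A" "m \<in> O'"
      using m orbit_subset_invariant[OF m inv] permutation_self_in_orbit[OF p]
      by (auto simp: O'_def cycles_def)
    have k1: "k \<ge> 1" using card_orbit_pos[OF p, of m] by (simp add: k_def O'_def)
    have cardS: "card (cycles A p) = Suc (card S)"
      unfolding S_def using fin O' by (intro card.remove) simp_all
    obtain r' where r: "r = Suc r'" and r': "card S + card A = r' + 2"
      using less.prems(5) True cardS by (cases r) auto
    have S_pos: "card C \<ge> 1" if C: "C \<in> S" for C
    proof -
      obtain x where "C = orbit p x" using C by (auto simp: S_def cycles_def)
      then show ?thesis using card_orbit_pos[OF p, of x] by simp
    qed
    have S_orbit: "orbit p x = C" if "C \<in> S" "x \<in> C" for C x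
      using cycles_eq_orbit[OF p, of C A x] that by (simp add: S_def)
    have UnS: "\<Union> S = A - O'"
    proof -
      have "\<Union> (cycles A p) = A" by (rule Union_cycles[OF p inv])
      moreover have "\<Union> (cycles A p) = O' \<union> \<Union> S" using O' by (auto simp: S_def)
      moreover have "O' \<inter> C = {}" if "C \<in> S" for C
        using cycles_disjoint[OF p O'(1), of C A] that by (auto simp: S_def)
      ultimately show ?thesis by blast
    qed
    let ?q = "\<lambda>s. p \<circ> Transposition.transpose s m"
    let ?Bs = "\<lambda>s. {B. B \<subseteq> A - {m} \<and> s \<in> B}"
    let ?g = "\<lambda>s B. \<Sum>i\<le>r'. card (factorizations B (?q s) i) * card (factorizations (A - B) (?q s) (r' - i))"
    \<comment> \<open>Counts the factorizations whose last transposition is (s m).\<close>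
    define t where "t s = card (factorizations A (?q s) r') + (\<Sum>B\<in>?Bs s. ?g s B)" for s
    have q: "permutation (?q s)" for s by (rule permutation_comp_transpose[OF p])
    have qinv: "?q s ` A \<subseteq> A" if "s \<in> A" for s
      by (rule transpose_image_subset[OF inv that m])
    have g_zero: "?g s B = 0" if "\<not> ?q s ` B \<subseteq> B" for s B
    proof -
      have "factorizations B (?q s) i = {}" for i
        using factorizations_nonempty_invariant that by blast
      then show ?thesis by simp
    qed
    \<comment> \<open>For s outside the cycle of m the product has s and m in one cycle, so no set
      separating them is invariant and all split terms vanish. One cycle and one transposition less
      keep the genus at zero.\<close>
    have join: "real (t s) = (\<Prod>C\<in>S - {orbit p s}. w C) * F (k + card (orbit p s)) (S - {orbit p s})"
      if s: "s \<in> A - O'" for s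
    proof -
      have sA: "s \<in> A" and sO: "s \<notin> orbit p m" using s by (auto simp: O'_def)
      have orb: "orbit (?q s) m = O' \<union> orbit p s"
        unfolding O'_def by (rule orbit_comp_transpose_join(1)[OF p sO])
      have "orbit p s \<in> cycles A p" using sA by (simp add: cycles_def)
      moreover have "O' \<noteq> orbit p s" using sO permutation_self_in_orbit[OF p, of s] by (auto simp: O'_def)
      ultimately have "O' \<inter> orbit p s = {}" by (intro cycles_disjoint[OF p O'(1)])
      then have card_orb: "card (orbit (?q s) m) = k + card (orbit p s)"
        unfolding orb k_def O'_def using p
        by (intro card_Un_disjoint finite_orbit permutation_self_in_orbit)
      have "s \<in> orbit (?q s) m" unfolding orb using permutation_self_in_orbit[OF p, of s] by simp
      then have "orbit (?q s) s = orbit (?q s) m" by (rule orbit_eq_of_mem[OF q])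
      then have ms: "m \<in> orbit (?q s) s" using permutation_self_in_orbit[OF q, of m s] by simp
      have "?g s B = 0" if "B \<in> ?Bs s" for B
      proof (rule g_zero)
        show "\<not> ?q s ` B \<subseteq> B"
          using orbit_subset_invariant[of s B "?q s"] that ms by auto
      qed
      then have "(\<Sum>B\<in>?Bs s. ?g s B) = 0" by (intro sum.neutral) blast
      then have "t s = card (factorizations A (?q s) r')" by (simp only: t_def add_0_right)
      moreover have c: "card (cycles A (?q s)) + card A = r' + 2"
        using card_cycles_comp_transpose_join[OF p sA m fin sO] less.prems(5) by (simp add: r)
      have "real (card (factorizations A (?q s) r')) = planar_count A (?q s)"
        by (rule less.IH[OF _ q qinv[OF sA] fin less.prems(4) c]) (simp add: r)
      moreover have "cycles A (?q s) - {orbit (?q s) m} = S - {orbit p s}"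
        using cycles_comp_transpose_join[OF p sA m sO] by (auto simp: S_def O'_def)
      ultimately show ?thesis
        using planar_count_eq_branch[OF q qinv[OF sA] fin m] by (simp add: card_orb w_def F_def)
    qed
    \<comment> \<open>For s = p^i m the cycle of m falls into pieces of lengths i (with s) and k - i
      (with m), and only the split terms survive.\<close>
    have cut: "real (t ((p ^^ i) m)) = (\<Prod>C\<in>S. w C) * (\<Sum>T\<in>Pow S. F i T * F (k - i) (S - T))"
      if i: "i \<in> {1..k - 1}" for i
    proof -
      define s where "s = (p ^^ i) m"
      define q where "q = ?q s"
      have perm_q: "permutation q" unfolding q_def by (rule q)
      have sO: "s \<in> O'" "s \<noteq> m"
        using bij_betw_apply[OF bij_betw_funpow_orbit[OF p, of m], of i] i by (auto simp: s_def O'_def k_def)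
      then have sA: "s \<in> A" using O'(2) by auto
      have q_inv: "q ` A \<subseteq> A" unfolding q_def by (rule qinv[OF sA])
      have sq: "s \<notin> orbit q m"
        unfolding q_def by (rule not_in_orbit_comp_transpose[OF p]) (use sO in \<open>auto simp: O'_def\<close>)
      have pq: "p = q \<circ> Transposition.transpose s m" by (simp add: q_def)
      define O1 O2 where "O1 = orbit q s" and "O2 = orbit q m"
      have O12: "O1 \<in> cycles A q" "O2 \<in> cycles A q" "s \<in> O1" "m \<in> O2"
        using sA m permutation_self_in_orbit[OF perm_q] by (auto simp: O1_def O2_def cycles_def)
      have "O1 \<noteq> O2" using sq O12 by (auto simp: O2_def)
      then have disj: "O1 \<inter> O2 = {}" by (rule cycles_disjoint[OF perm_q O12(1,2)])
      have "O' = O2 \<union> O1"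
        unfolding O'_def O1_def O2_def using orbit_comp_transpose_join(1)[OF perm_q sq] pq by simp
      moreover have "finite O1" "finite O2"
        unfolding O1_def O2_def by (intro finite_orbit permutation_self_in_orbit perm_q)+
      moreover have card1: "card O1 = i"
        unfolding O1_def q_def
        by (rule orbit_comp_transpose_cut(2)[OF p]) (use i in \<open>auto simp: s_def k_def O'_def\<close>)
      ultimately have card2: "card O2 = k - i"
        unfolding k_def using disj by (simp add: card_Un_disjoint Int_commute)
      have S: "S = cycles A q - {O2, O1}"
        unfolding S_def O'_def O1_def O2_def using cycles_comp_transpose_join[OF perm_q sA m sq] pq by simp
      then have cycA: "cycles A q = insert O1 (insert O2 S)" and notS: "O1 \<notin> S" "O2 \<notin> S"
        using O12 by auto
      have card_cyc: "card (cycles A q) = card S + 2"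
        unfolding cycA using notS \<open>O1 \<noteq> O2\<close> finS by simp
      \<comment> \<open>One transposition less and one cycle more would be genus -1.\<close>
      have "factorizations A q r' = {}"
        using genus_nonnegative[OF perm_q fin less.prems(4), of r'] card_cyc r' by auto
      then have t: "t s = (\<Sum>B\<in>?Bs s. ?g s B)" by (simp add: t_def q_def)
      \<comment> \<open>The invariant subsets of \<open>A\<close> containing s but not m are the
        unions of \<open>O1\<close> with a set \<open>T\<close> of untouched cycles;
        \<open>U\<close> enumerates them.\<close>
      define U where "U T = \<Union> (insert O1 T)" for T
      have disjS: "C \<inter> D = {}" if "C \<in> cycles A q" "D \<in> cycles A q" "C \<noteq> D" for C D
        using cycles_disjoint[OF perm_q that] .
      have U_cyc: "cycles (U T) q = insert O1 T" if "T \<subseteq> S" for T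
        unfolding U_def using that cycA by (intro cycles_Union[OF perm_q, where A = A]) auto
      have U_inv: "q ` U T \<subseteq> U T" if "T \<subseteq> S" for T
        unfolding U_def using that cycA by (intro Union_cycles_invariant[where A = A]) auto
      have U_compl: "A - U T = \<Union> (insert O2 (S - T))" if "T \<subseteq> S" for T
      proof -
        have "A = \<Union> (cycles A q)" using Union_cycles[OF perm_q q_inv] by simp
        also have "cycles A q = insert O1 T \<union> insert O2 (S - T)" using cycA that by auto
        finally have "A = U T \<union> \<Union> (insert O2 (S - T))" by (simp only: U_def Union_Un_distrib)
        moreover have "C \<inter> D = {}" if "C \<in> insert O1 T" "D \<in> insert O2 (S - T)" for C D
          using that \<open>T \<subseteq> S\<close> cycA notS \<open>O1 \<noteq> O2\<close> by (intro disjS) auto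
        then have "U T \<inter> \<Union> (insert O2 (S - T)) = {}" unfolding U_def by blast
        ultimately show ?thesis by blast
      qed
      have U_mem: "U T \<in> ?Bs s" if "T \<subseteq> S" for T
      proof -
        have "m \<in> A - U T" using U_compl[OF that] O12 by auto
        moreover have "U T \<subseteq> A"
          unfolding U_def using that cycA cycles_subset[OF q_inv] by blast
        ultimately show ?thesis using O12 by (auto simp: U_def)
      qed
      have inj: "inj_on U (Pow S)"
      proof (rule inj_onI)
        fix T T' assume T: "T \<in> Pow S" "T' \<in> Pow S" "U T = U T'"
        then have "insert O1 T = insert O1 T'" using U_cyc by (metis PowD)
        then show "T = T'" using T notS by auto
      qed
      have "t s = (\<Sum>B\<in>U ` Pow S. ?g s B)"
        unfolding t
      proof (rule sum.mono_neutral_right)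
        show "finite (?Bs s)" using fin by auto
        show "U ` Pow S \<subseteq> ?Bs s" using U_mem by auto
        show "\<forall>B\<in>?Bs s - U ` Pow S. ?g s B = 0"
        proof
          fix B assume B: "B \<in> ?Bs s - U ` Pow S"
          have "\<not> q ` B \<subseteq> B"
          proof
            assume Binv: "q ` B \<subseteq> B"
            have "cycles B q \<subseteq> cycles A q" using B by (auto simp: cycles_def)
            moreover have "O2 \<notin> cycles B q"
              using cycles_subset[OF Binv, of O2] O12 B by auto
            moreover have "O1 \<in> cycles B q" using B by (auto simp: O1_def cycles_def)
            ultimately have "cycles B q - {O1} \<subseteq> S" "cycles B q = insert O1 (cycles B q - {O1})"
              using cycA by auto
            moreover have "\<Union> (cycles B q) = B" by (rule Union_cycles[OF perm_q Binv])
            ultimately have "B = U (cycles B q - {O1})" "cycles B q - {O1} \<in> Pow S"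
              unfolding U_def by auto
            then show False using B by blast
          qed
          then show "?g s B = 0" unfolding q_def by (rule g_zero)
        qed
      qed
      also have "\<dots> = (\<Sum>T\<in>Pow S. ?g s (U T))"
        by (simp add: sum.reindex[OF inj])
      finally have "real (t s) = (\<Sum>T\<in>Pow S. real (?g s (U T)))" by simp
      also have "\<dots> = (\<Sum>T\<in>Pow S. (\<Prod>C\<in>S. w C) * (F i T * F (k - i) (S - T)))"
      proof (rule sum.cong)
        fix T assume "T \<in> Pow S"
        then have T: "T \<subseteq> S" by simp
        define B where "B = U T"
        have finT: "finite T" using T finS finite_subset by auto
        have B: "B \<subseteq> A" "s \<in> B" "m \<in> A - B" using U_mem[OF T] m by (auto simp: B_def)
        have finB: "finite B" using B(1) fin finite_subset by auto
        have cycB: "cycles B q = insert O1 T" unfolding B_def by (rule U_cyc[OF T])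
        have cycAB: "cycles (A - B) q = insert O2 (S - T)"
          unfolding B_def U_compl[OF T] using cycA by (intro cycles_Union[OF perm_q, where A = A]) auto
        have invB: "q ` B \<subseteq> B" unfolding B_def by (rule U_inv[OF T])
        have invAB: "q ` (A - B) \<subseteq> A - B"
          unfolding B_def U_compl[OF T] using cycA by (intro Union_cycles_invariant[where A = A]) auto
        have c1: "card (cycles B q) = Suc (card T)"
          unfolding cycB using T notS finT by (simp add: card_insert_if) blast
        have c2: "card (cycles (A - B) q) = Suc (card (S - T))"
          unfolding cycAB using notS finS by (simp add: card_insert_if)
        have cT: "card S = card T + card (S - T)"
          using card_Diff_subset[OF finT T] card_mono[OF finS T] by simp
        have cB: "card A = card B + card (A - B)"
          using card_Diff_subset[OF finB B(1)] card_mono[OF fin B(1)] by simp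
        have pos: "card B \<ge> 1" "card (A - B) \<ge> 1"
          using B finB fin by (auto simp: Suc_le_eq card_gt_0_iff)
        \<comment> \<open>The number of transpositions that gives genus zero on both sides. Fewer on
          \<open>B\<close> contradict \<open>genus_nonnegative\<close> for \<open>B\<close>; more
          leave too few for A - B.\<close>
        define j where "j = card T + card B - 1"
        have j1: "card (cycles B q) + card B = j + 2" using c1 pos by (simp add: j_def)
        have jr: "j \<le> r'" using cT cB r' pos by (simp add: j_def)
        have j2: "card (cycles (A - B) q) + card (A - B) = r' - j + 2"
          using c2 cT cB r' pos by (simp add: j_def)
        have "?g s B = (\<Sum>i\<in>{j}. card (factorizations B q i) * card (factorizations (A - B) q (r' - i)))"
          unfolding q_def[symmetric]
        proof (rule sum.mono_neutral_right)
          show "\<forall>i\<in>{..r'} - {j}. card (factorizations B q i) * card (factorizations (A - B) q (r' - i)) = 0"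
          proof
            fix i assume i: "i \<in> {..r'} - {j}"
            show "card (factorizations B q i) * card (factorizations (A - B) q (r' - i)) = 0"
            proof (cases "i < j")
              case True
              then have "factorizations B q i = {}"
                using genus_nonnegative[OF perm_q finB, of i] B j1 by auto
              then show ?thesis by simp
            next
              case False
              have "A - B \<noteq> {}" using B(3) by auto
              have "factorizations (A - B) q (r' - i) = {}"
              proof (rule ccontr)
                assume "\<not> ?thesis"
                then have "card (cycles (A - B) q) + card (A - B) \<le> r' - i + 2"
                  using fin \<open>A - B \<noteq> {}\<close> by (intro genus_nonnegative perm_q) auto
                then show False using False i j2 by auto
              qed
              then show ?thesis by simp
            qed
          qed
        qed (use jr in auto)
        then have "real (?g s B) = real (card (factorizations B q j)) * real (card (factorizations (A - B) q (r' - j)))"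
          by simp
        also have "real (card (factorizations B q j)) = planar_count B q"
          using jr B by (intro less.IH perm_q invB finB j1) (auto simp: r)
        also have "\<dots> = (\<Prod>C\<in>T. w C) * F i T"
        proof -
          have "cycles B q - {orbit q s} = T"
            unfolding cycB O1_def[symmetric] using notS T by auto
          then show ?thesis
            using planar_count_eq_branch[OF perm_q invB finB B(2)] card1
            by (simp add: w_def F_def O1_def[symmetric])
        qed
        also have "real (card (factorizations (A - B) q (r' - j))) = planar_count (A - B) q"
          using B fin by (intro less.IH perm_q invAB j2) (auto simp: r)
        also have "\<dots> = (\<Prod>C\<in>S - T. w C) * F (k - i) (S - T)"
        proof -
          have "cycles (A - B) q - {orbit q m} = S - T"
            unfolding cycAB O2_def[symmetric] using notS by auto
          then show ?thesis
            using planar_count_eq_branch[OF perm_q invAB _ B(3)] card2 fin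
            by (simp add: w_def F_def O2_def[symmetric])
        qed
        also have "(\<Prod>C\<in>T. w C) * F i T * ((\<Prod>C\<in>S - T. w C) * F (k - i) (S - T))
            = (\<Prod>C\<in>S. w C) * (F i T * F (k - i) (S - T))"
          unfolding prod.subset_diff[OF T finS, of w] by simp
        finally show "real (?g s (U T)) = (\<Prod>C\<in>S. w C) * (F i T * F (k - i) (S - T))"
          unfolding B_def .
      qed simp
      finally show ?thesis unfolding s_def by (simp add: sum_distrib_left)
    qed
    have "card (factorizations A p r) = (\<Sum>s\<in>A - {m}. t s)"
      unfolding r card_factorizations_Suc[OF fin True m_def] t_def ..
    also have "A - {m} = (A - O') \<union> (O' - {m})" using O' by auto
    also have "(\<Sum>s\<in>(A - O') \<union> (O' - {m}). t s) = (\<Sum>s\<in>A - O'. t s) + (\<Sum>s\<in>O' - {m}. t s)"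
      using fin O' finite_subset by (intro sum.union_disjoint) auto
    also have "(\<Sum>s\<in>O' - {m}. t s) = (\<Sum>i = 1..k - 1. t ((p ^^ i) m))"
      using sum.reindex_bij_betw[OF bij_betw_funpow_orbit[OF p, of m], of t] by (simp add: O'_def k_def)
    finally have "real (card (factorizations A p r))
        = (\<Sum>s\<in>A - O'. real (t s)) + (\<Sum>i = 1..k - 1. real (t ((p ^^ i) m)))" by simp
    also have "(\<Sum>i = 1..k - 1. real (t ((p ^^ i) m)))
        = (\<Prod>C\<in>S. w C) * (\<Sum>i = 1..k - 1. \<Sum>T\<in>Pow S. F i T * F (k - i) (S - T))"
      using cut by (simp add: sum_distrib_left)
    also have "(\<Sum>s\<in>A - O'. real (t s)) = (\<Sum>C\<in>S. \<Sum>s\<in>C. real (t s))"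
      unfolding UnS[symmetric]
    proof (subst sum.Union_disjoint)
      show "\<forall>C\<in>S. finite C" using S_pos by (metis card.infinite not_one_le_zero)
      show "\<forall>C\<in>S. \<forall>D\<in>S. C \<noteq> D \<longrightarrow> C \<inter> D = {}"
        by (intro ballI impI cycles_disjoint[OF p, where A = A and B = A]) (auto simp: S_def)
    qed simp
    \<comment> \<open>All points of \<open>C\<close> contribute equally, and \<open>card C\<close>
      times the product without \<open>C\<close> is the full product divided by
      \<open>central_binomial (card C)\<close>.\<close>
    also have "\<dots> = (\<Sum>C\<in>S. (\<Prod>C\<in>S. w C) * (F (k + card C) (S - {C}) / central_binomial (card C)))"
    proof (rule sum.cong)
      fix C assume C: "C \<in> S"
      have "real (t s) = (\<Prod>D\<in>S - {C}. w D) * F (k + card C) (S - {C})" if "s \<in> C" for s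
        using join[of s] S_orbit[OF C that] C that UnS by auto
      then have "(\<Sum>s\<in>C. real (t s)) = real (card C) * ((\<Prod>D\<in>S - {C}. w D) * F (k + card C) (S - {C}))"
        by simp
      then show "(\<Sum>s\<in>C. real (t s)) = (\<Prod>C\<in>S. w C) * (F (k + card C) (S - {C}) / central_binomial (card C))"
        unfolding prod.remove[OF finS C] by (simp add: w_def)
    qed simp
    also have "\<dots> = (\<Prod>C\<in>S. w C) * (\<Sum>C\<in>S. F (k + card C) (S - {C}) / central_binomial (card C))"
      by (simp add: sum_distrib_left)
    finally have "real (card (factorizations A p r)) = (\<Prod>C\<in>S. w C)
        * ((\<Sum>C\<in>S. F (k + card C) (S - {C}) / central_binomial (card C))
           + (\<Sum>i = 1..k - 1. \<Sum>T\<in>Pow S. F i T * F (k - i) (S - T)))"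
      by (simp add: distrib_left)
    also have "\<dots> = (\<Prod>C\<in>S. w C) * F k S"
    proof -
      have "k \<ge> 2 \<or> S \<noteq> {}"
      proof (cases "S = {}")
        case True
        then have "O' = A" using UnS O' by auto
        then show ?thesis using \<open>card A \<ge> 2\<close> by (simp add: k_def)
      qed simp
      then show ?thesis unfolding F_def by (subst branch_join_cut[OF finS k1]) simp_all
    qed
    also have "\<dots> = planar_count A p"
      using planar_count_eq_branch[OF p inv fin m] by (simp add: S_def O'_def k_def w_def F_def)
    finally show ?thesis .
  qed
qed

section \<open>Permutations of given cycle type\<close>

lemma sum_mset_eq_sum_count:
  assumes "finite X" "set_mset M \<subseteq> X"
  shows "sum_mset M = (\<Sum>j\<in>X. j * count M (j :: nat))"
  using assms(2)
proof (induction M)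
  case (add x M)
  have "(\<Sum>j\<in>X. j * count (add_mset x M) j) = (\<Sum>j\<in>X. j * count M j + (if j = x then j else 0))"
    by (intro sum.cong) auto
  also have "\<dots> = (\<Sum>j\<in>X. j * count M j) + x"
    using assms(1) add.prems by (simp add: sum.distrib)
  finally show ?case using add by simp
qed simp

lemma card_Aut_add_mset: "card_Aut (add_mset k M) = card_Aut M * Suc (count M k)"
proof -
  let ?X = "insert k (set_mset M)"
  have eq: "card_Aut N = (\<Prod>j\<in>?X. fact (count N j))" if "set_mset N \<subseteq> ?X" for N
    unfolding card_Aut_def by (rule prod.mono_neutral_left) (use that in \<open>auto simp: not_in_iff\<close>)
  have "card_Aut (add_mset k M) = fact (Suc (count M k)) * (\<Prod>j\<in>?X - {k}. fact (count M j))"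
    by (subst eq, simp, subst prod.remove[of _ k]) auto
  moreover have "card_Aut M = fact (count M k) * (\<Prod>j\<in>?X - {k}. fact (count M j))"
    by (subst eq, blast, subst prod.remove[of _ k]) auto
  ultimately show ?thesis by (simp add: algebra_simps)
qed

text \<open>\<open>cycle_type\<close> on an arbitrary set, so that points can be inserted one at a
  time.\<close>

definition cycle_mset :: "'a set \<Rightarrow> ('a \<Rightarrow> 'a) \<Rightarrow> nat multiset" where
  "cycle_mset A p = image_mset card (mset_set (cycles A p))"

lemma cycle_type_eq_cycle_mset: "cycle_type d p = cycle_mset {1..d} p"
  by (simp add: cycle_type_def cycle_mset_def cycles_def)

lemma cycle_mset_remove:
  assumes "finite A" "C \<in> cycles A p"
  shows "cycle_mset A p = add_mset (card C) (image_mset card (mset_set (cycles A p - {C})))"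
  unfolding cycle_mset_def using assms by (subst mset_set.remove[of _ C]) simp_all

lemma permutes_imp_invariant: "p permutes A \<Longrightarrow> p ` A \<subseteq> A"
  using permutes_image by blast

lemma permutes_finite_imp_permutation: "p permutes A \<Longrightarrow> finite A \<Longrightarrow> permutation p"
  by (auto simp: permutation_permutes)

lemma card_cycles_of_length:
  assumes p: "p permutes A" and fin: "finite A"
  shows "card {b \<in> A. card (orbit p b) = k} = k * count (cycle_mset A p) k"
proof -
  note perm = permutes_finite_imp_permutation[OF p fin]
  define X where "X = {C \<in> cycles A p. card C = k}"
  have finX: "finite X" using fin by (simp add: X_def)
  have "{b \<in> A. card (orbit p b) = k} = \<Union> X"
  proof (intro equalityI subsetI)
    fix b assume "b \<in> {b \<in> A. card (orbit p b) = k}"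
    then show "b \<in> \<Union> X"
      using permutation_self_in_orbit[OF perm, of b] by (auto simp: X_def cycles_def)
  next
    fix b assume "b \<in> \<Union> X"
    then obtain C where C: "C \<in> cycles A p" "card C = k" "b \<in> C" by (auto simp: X_def)
    then have "C = orbit p b" by (intro cycles_eq_orbit[OF perm])
    moreover have "C \<subseteq> A" by (rule cycles_subset[OF permutes_imp_invariant[OF p] C(1)])
    ultimately show "b \<in> {b \<in> A. card (orbit p b) = k}" using C by auto
  qed
  moreover have "card (\<Union> X) = (\<Sum>C\<in>X. card C)"
  proof (rule card_Union_disjoint)
    show "pairwise disjnt X"
      unfolding pairwise_def disjnt_def X_def
      using cycles_disjoint[OF perm, where A = A and B = A] by blast
    show "finite C" if "C \<in> X" for C
      using that cycles_subset[OF permutes_imp_invariant[OF p], of C] fin finite_subset by (auto simp: X_def)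
  qed
  moreover have "(\<Sum>C\<in>X. card C) = k * card X" by (simp add: X_def)
  moreover have "count (cycle_mset A p) k = card X"
  proof -
    have "count (cycle_mset A p) k = (\<Sum>C\<in>X. count (mset_set (cycles A p)) C)"
      unfolding cycle_mset_def count_image_mset'
      by (rule sum.cong) (use fin in \<open>auto simp: X_def\<close>)
    also have "\<dots> = (\<Sum>C\<in>X. 1)" by (rule sum.cong) (use fin in \<open>auto simp: X_def\<close>)
    finally show ?thesis by simp
  qed
  ultimately show ?thesis by simp
qed

lemma cycles_insert_fixed:
  assumes "p permutes A" "a \<notin> A"
  shows "cycles (insert a A) p = insert {a} (cycles A p)" "{a} \<notin> cycles A p" "orbit p a = {a}"
proof -
  have "p a = a" using assms by (rule permutes_not_in)
  then show orb: "orbit p a = {a}" by (simp add: orbit_eq_singleton_iff)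
  then show "cycles (insert a A) p = insert {a} (cycles A p)" by (simp add: cycles_def)
  show "{a} \<notin> cycles A p"
    using cycles_subset[OF permutes_imp_invariant[OF assms(1)], of "{a}"] assms(2) by auto
qed

lemma cycle_mset_insert_fixed:
  assumes "p permutes A" "a \<notin> A" "finite A"
  shows "cycle_mset (insert a A) p = add_mset 1 (cycle_mset A p)"
  unfolding cycle_mset_def cycles_insert_fixed(1)[OF assms(1,2)]
  using assms(3) cycles_insert_fixed(2)[OF assms(1,2)] by simp

text \<open>Since \<open>p\<close> fixes \<open>a\<close>, the product sends b to a and a to p b: it
  inserts \<open>a\<close> right after \<open>b\<close>. Adding one cycle length on each side of the
  last equation avoids multiset subtraction.\<close>

lemma insert_into_cycle:
  assumes p: "p permutes A" and fin: "finite A" and a: "a \<notin> A" and b: "b \<in> A"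
  defines "q \<equiv> p \<circ> Transposition.transpose b a"
  shows "q permutes insert a A" "card (orbit q a) = Suc (card (orbit p b))"
    and "add_mset (card (orbit p b)) (cycle_mset (insert a A) q)
       = add_mset (Suc (card (orbit p b))) (cycle_mset A p)"
proof -
  note perm = permutes_finite_imp_permutation[OF p fin]
  have orba: "orbit p a = {a}" by (rule cycles_insert_fixed(3)[OF p a])
  have ba: "b \<notin> orbit p a" using orba a b by auto
  show "q permutes insert a A"
    unfolding q_def
    by (intro permutes_compose permutes_swap_id permutes_imp_permutes_insert[OF p]) (use b in auto)
  have orbq: "orbit q a = insert a (orbit p b)"
    unfolding q_def orbit_comp_transpose_join(1)[OF perm ba] orba by simp
  have sub: "orbit p b \<subseteq> A" by (rule orbit_subset_invariant[OF b permutes_imp_invariant[OF p]])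
  show card: "card (orbit q a) = Suc (card (orbit p b))"
    unfolding orbq using sub a finite_subset[OF sub fin] by (auto simp: card_insert_if)
  have "cycles (insert a A) q - {orbit q a} = cycles (insert a A) p - {orbit p a, orbit p b}"
    unfolding q_def using b by (intro cycles_comp_transpose_join[OF perm _ _ ba]) auto
  also have "\<dots> = cycles A p - {orbit p b}"
    unfolding cycles_insert_fixed(1)[OF p a] orba using cycles_insert_fixed(2)[OF p a] by auto
  finally have rest: "cycles (insert a A) q - {orbit q a} = cycles A p - {orbit p b}" .
  have "cycle_mset (insert a A) q = add_mset (Suc (card (orbit p b))) (image_mset card (mset_set (cycles A p - {orbit p b})))"
    using cycle_mset_remove[of "insert a A" "orbit q a" q] fin unfolding rest card by (simp add: cycles_def)
  moreover have "cycle_mset A p = add_mset (card (orbit p b)) (image_mset card (mset_set (cycles A p - {orbit p b})))"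
    using b by (intro cycle_mset_remove fin) (simp add: cycles_def)
  ultimately show "add_mset (card (orbit p b)) (cycle_mset (insert a A) q)
       = add_mset (Suc (card (orbit p b))) (cycle_mset A p)" by simp
qed

text \<open>Deleting \<open>a\<close> from its cycle and remembering its predecessor b is a
  bijection. What is left has \<open>Suc (count M k)\<close> cycles of length \<open>k\<close>, each
  offering \<open>k\<close> choices of b.\<close>

lemma card_permutes_longer_cycle:
  assumes fin: "finite A" and a: "a \<notin> A" and k: "k \<ge> 1"
  shows "card {q. q permutes insert a A \<and> cycle_mset (insert a A) q = add_mset (Suc k) M \<and> card (orbit q a) = Suc k}
    = card {p. p permutes A \<and> cycle_mset A p = add_mset k M} * (k * Suc (count M k))"
    (is "card ?Q = card ?P * _")
proof -
  let ?D = "Sigma ?P (\<lambda>p. {b \<in> A. card (orbit p b) = k})"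
  let ?f = "\<lambda>(p, b). p \<circ> Transposition.transpose b a"
  have finP: "finite ?P"
    using finite_permutations[OF fin] by (rule finite_subset[rotated]) auto
  have "inj_on ?f ?D"
  proof (rule inj_onI, clarify)
    fix p b p' b'
    assume p: "p permutes A" and p': "p' permutes A" and b: "b \<in> A" "b' \<in> A"
      and eq: "p \<circ> Transposition.transpose b a = p' \<circ> Transposition.transpose b' a"
    have "(p \<circ> Transposition.transpose b a) b = a" using permutes_not_in[OF p a] by simp
    moreover have "(p' \<circ> Transposition.transpose b' a) b' = a" using permutes_not_in[OF p' a] by simp
    moreover have "inj (p' \<circ> Transposition.transpose b' a)"
      by (intro inj_compose permutes_inj[OF p'] inj_transpose)
    ultimately have "b = b'" unfolding eq by (metis injD)
    then have "p = p'" using eq comp_transpose_twice by metis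
    then show "p = p' \<and> b = b'" using \<open>b = b'\<close> by simp
  qed
  moreover have "?f ` ?D = ?Q"
  proof (intro equalityI subsetI)
    fix q assume "q \<in> ?f ` ?D"
    then obtain p b where q: "q = p \<circ> Transposition.transpose b a" and p: "p permutes A"
      "cycle_mset A p = add_mset k M" and b: "b \<in> A" "card (orbit p b) = k" by auto
    show "q \<in> ?Q"
      using insert_into_cycle[OF p(1) fin a b(1)] b(2) p(2) unfolding q by (simp add: add_mset_commute)
  next
    fix q assume "q \<in> ?Q"
    then have q: "q permutes insert a A" "cycle_mset (insert a A) q = add_mset (Suc k) M"
      "card (orbit q a) = Suc k" by auto
    define b where "b = inv' q a"
    have qb: "q b = a" unfolding b_def by (rule permutes_inverses(1)[OF q(1)])
    have "b \<noteq> a"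
    proof
      assume "b = a"
      then have "orbit q a = {a}" using qb by (simp add: orbit_eq_singleton_iff)
      then show False using q(3) k by simp
    qed
    moreover have "b \<in> insert a A" using permutes_in_image[OF q(1), of b] qb by simp
    ultimately have b: "b \<in> A" by simp
    define p where "p = q \<circ> Transposition.transpose b a"
    have "p permutes insert a A"
      unfolding p_def by (intro permutes_compose permutes_swap_id q(1)) (use b in auto)
    moreover have "p a = a" by (simp add: p_def qb)
    ultimately have p: "p permutes A" by (intro permutes_superset[of p "insert a A" A]) auto
    have qp: "q = p \<circ> Transposition.transpose b a" by (simp add: p_def)
    note ins = insert_into_cycle[OF p fin a b, folded qp]
    have "card (orbit p b) = k" using ins(2) q(3) by simp
    moreover from this have "cycle_mset A p = add_mset k M"
      using ins(3) unfolding q(2) by (simp add: add_mset_commute[of k])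
    ultimately show "q \<in> ?f ` ?D" using p b qp by (intro image_eqI[of _ _ "(p, b)"]) auto
  qed
  ultimately have "bij_betw ?f ?D ?Q" unfolding bij_betw_def ..
  then have "card ?Q = card ?D" by (rule bij_betw_same_card[symmetric])
  also have "\<dots> = (\<Sum>p\<in>?P. card {b \<in> A. card (orbit p b) = k})"
    using finP fin by (intro card_SigmaI) auto
  also have "\<dots> = (\<Sum>p\<in>?P. k * Suc (count M k))"
    by (rule sum.cong) (use fin in \<open>auto simp: card_cycles_of_length\<close>)
  finally show ?thesis by simp
qed

text \<open>The class size d! / (|Aut| prod a_i) in multiplied form. Sorted by the length j of the
  cycle through the new point, the permutations contribute |A|! j count M j, and these add up to
  |A|! (|A| + 1).\<close>

theorem card_permutes_cycle_mset:
  assumes "finite A" "0 \<notin># M" "sum_mset M = card A"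
  shows "card {p. p permutes A \<and> cycle_mset A p = M} * (card_Aut M * prod_mset M) = fact (card A)"
  using assms
proof (induction A arbitrary: M rule: finite_induct)
  case empty
  have "M = {#}"
  proof (rule ccontr)
    assume "M \<noteq> {#}"
    then obtain x N where "M = add_mset x N" by (cases M) auto
    then show False using empty by auto
  qed
  moreover have "{p. p permutes {} \<and> cycle_mset {} p = {#}} = {id :: 'a \<Rightarrow> 'a}"
    by (auto simp: cycle_mset_def cycles_def)
  ultimately show ?case by (simp add: card_Aut_def)
next
  case (insert a A)
  define X where "X = {q. q permutes insert a A \<and> cycle_mset (insert a A) q = M}"
  define Y where "Y j = {q \<in> X. card (orbit q a) = j}" for j
  have finX: "finite X"
    unfolding X_def using finite_permutations[of "insert a A"] insert.hyps(1)
    by (auto intro: finite_subset[rotated])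
  have X_eq: "X = (\<Union>j\<in>set_mset M. Y j)"
  proof (intro equalityI subsetI)
    fix q assume q: "q \<in> X"
    have "orbit q a \<in> cycles (insert a A) q" by (simp add: cycles_def)
    then have "card (orbit q a) \<in># cycle_mset (insert a A) q"
      using insert.hyps(1) by (simp add: cycle_mset_def)
    then show "q \<in> (\<Union>j\<in>set_mset M. Y j)" using q by (auto simp: X_def Y_def)
  qed (auto simp: Y_def)
  have "card X = (\<Sum>j\<in>set_mset M. card (Y j))"
    by (subst X_eq, rule card_UN_disjoint) (use finX in \<open>auto simp: Y_def\<close>)
  moreover have "card (Y j) * (card_Aut M * prod_mset M) = fact (card A) * (j * count M j)"
    if j: "j \<in># M" for j
  proof -
    obtain N where M: "M = add_mset j N" using j by (metis insert_DiffM)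
    have "j \<noteq> 0" using j insert.prems(1) by metis
    then obtain k where k: "j = Suc k" by (cases j) auto
    have N: "0 \<notin># N" "sum_mset N + k = card A"
      using insert.prems insert.hyps by (auto simp: M k)
    \<comment> \<open>For k >= 1 the number of insertion points is exactly the factor by which
      \<open>card_Aut\<close> times \<open>prod_mset\<close> grows from \<open>N\<close> to
      \<open>add_mset k N\<close>; so the outcome is the same as for a new fixed point.\<close>
    have "card (Y j) * (card_Aut N * prod_mset N) = fact (card A)"
    proof (cases "k = 0")
      case True
      have "Y j = {p. p permutes A \<and> cycle_mset A p = N}"
      proof (intro equalityI subsetI)
        fix q assume "q \<in> Y j"
        then have q: "q permutes insert a A" "cycle_mset (insert a A) q = add_mset 1 N" "card (orbit q a) = 1"
          by (auto simp: Y_def X_def M k True)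
        obtain x where "orbit q a = {x}" using q(3) card_1_singletonE by metis
        moreover have "a \<in> orbit q a"
          by (intro permutation_self_in_orbit permutes_finite_imp_permutation[OF q(1)]) (use insert.hyps(1) in simp)
        ultimately have "orbit q a = {a}" by auto
        then have "q a = a" by (simp add: orbit_eq_singleton_iff)
        then have "q permutes A" using q(1) by (intro permutes_superset[of q "insert a A" A]) auto
        then show "q \<in> {p. p permutes A \<and> cycle_mset A p = N}"
          using cycle_mset_insert_fixed[of q A a] q(2) insert.hyps by auto
      next
        fix p assume "p \<in> {p. p permutes A \<and> cycle_mset A p = N}"
        then show "p \<in> Y j"
          using cycle_mset_insert_fixed[of p A a] cycles_insert_fixed(3)[of p A a] insert.hyps
          by (auto simp: Y_def X_def M k True permutes_imp_permutes_insert)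
      qed
      then show ?thesis using insert.IH[of N] N True by simp
    next
      case False
      have "Y j = {q. q permutes insert a A \<and> cycle_mset (insert a A) q = add_mset (Suc k) N \<and> card (orbit q a) = Suc k}"
        by (auto simp: Y_def X_def M k)
      then have "card (Y j) = card {p. p permutes A \<and> cycle_mset A p = add_mset k N} * (k * Suc (count N k))"
        using card_permutes_longer_cycle[OF insert.hyps, of k N] False by simp
      moreover have "card {p. p permutes A \<and> cycle_mset A p = add_mset k N}
          * (card_Aut (add_mset k N) * prod_mset (add_mset k N)) = fact (card A)"
        using N False by (intro insert.IH) auto
      ultimately show ?thesis by (simp add: card_Aut_add_mset algebra_simps)
    qed
    from this[symmetric] show ?thesis by (simp add: M card_Aut_add_mset algebra_simps)
  qed
  ultimately have "card X * (card_Aut M * prod_mset M) = (\<Sum>j\<in>set_mset M. fact (card A) * (j * count M j))"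
    by (simp add: sum_distrib_right)
  also have "\<dots> = fact (card A) * sum_mset M"
    by (simp add: sum_distrib_left[symmetric] sum_mset_eq_sum_count[of "set_mset M"])
  also have "\<dots> = fact (card (insert a A))"
    using insert.prems insert.hyps by simp
  finally show ?case unfolding X_def .
qed

section \<open>Monotone Hurwitz numbers\<close>

lemma transpose_eq_transpose_iff:
  fixes s t s' t' :: "'a::linorder"
  assumes "s < t" "s' < t'"
  shows "Transposition.transpose s t = Transposition.transpose s' t' \<longleftrightarrow> s = s' \<and> t = t'"
proof
  assume eq: "Transposition.transpose s t = Transposition.transpose s' t'"
  have "Transposition.transpose s' t' s = t" using fun_cong[OF eq, of s] by simp
  then have "(s = s' \<and> t = t') \<or> (s = t' \<and> t = s')"
    using assms(1) by (auto simp: Transposition.transpose_def split: if_splits)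
  then show "s = s' \<and> t = t'" using assms by auto
qed simp

abbreviation transposition_of :: "'a \<times> 'a \<Rightarrow> 'a \<Rightarrow> 'a" where
  "transposition_of e \<equiv> Transposition.transpose (fst e) (snd e)"

lemma foldr_transpositions: "foldr (\<circ>) (map transposition_of L) id = perm_of L"
  by (induction L) simp_all

lemma monotone_transpositions_iff:
  "monotone_transpositions d ts
    \<longleftrightarrow> (\<exists>L. ts = map transposition_of L \<and> set L \<subseteq> edges {1..d} \<and> sorted (map snd L))"
proof
  assume "monotone_transpositions d ts"
  then obtain s t where st: "length s = length ts" "length t = length ts" "sorted t"
    "\<And>i. i < length ts \<Longrightarrow> s ! i \<in> {1..d} \<and> t ! i \<in> {1..d} \<and> s ! i < t ! i \<and>
       ts ! i = Transposition.transpose (s ! i) (t ! i)"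
    unfolding monotone_transpositions_def by blast
  have "ts = map transposition_of (zip s t)"
    using st by (intro nth_equalityI) auto
  moreover have "set (zip s t) \<subseteq> edges {1..d}"
    using st(1,2,4) by (force simp: set_zip edges_def)
  moreover have "map snd (zip s t) = t" using st(1,2) by simp
  ultimately show "\<exists>L. ts = map transposition_of L \<and> set L \<subseteq> edges {1..d} \<and> sorted (map snd L)"
    using st(3) by metis
next
  assume "\<exists>L. ts = map transposition_of L \<and> set L \<subseteq> edges {1..d} \<and> sorted (map snd L)"
  then obtain L where L: "ts = map transposition_of L" "set L \<subseteq> edges {1..d}" "sorted (map snd L)"
    by blast
  have "L ! i \<in> edges {1..d}" if "i < length L" for i using L(2) that nth_mem by blast
  then show "monotone_transpositions d ts"
    unfolding monotone_transpositions_def using L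
    by (intro exI[of _ "map fst L"] exI[of _ "map snd L"]) (auto simp: edges_def case_prod_beta)
qed

text \<open>Counting edge lists is counting lists of permutations, because s < t fixes the order
  within each pair.\<close>

lemma inj_on_map_transpositions: "inj_on (map transposition_of) {L. set L \<subseteq> edges A}"
proof (rule inj_onI)
  fix L M assume "L \<in> {L. set L \<subseteq> edges A}" "M \<in> {L. set L \<subseteq> edges A}"
    "map transposition_of L = map transposition_of M"
  then show "L = M"
  proof (induction L arbitrary: M)
    case (Cons e L)
    then obtain e' M' where M: "M = e' # M'" by (cases M) auto
    have "fst e < snd e" "fst e' < snd e'" using Cons.prems by (auto simp: M edges_def)
    then have "e = e'"
      using Cons.prems(3) by (auto simp: M transpose_eq_transpose_iff prod_eq_iff)
    then show ?case using Cons by (simp add: M)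
  qed simp
qed

text \<open>\<open>s\<close> is the inverse of the product of the transpositions, so it preserves
  every set that they preserve. The orbits of the group are therefore the components of the
  graph.\<close>

lemma generates_transitive_iff_connects:
  assumes L: "set L \<subseteq> edges {1..d}" and s: "s permutes {1..d}" "s \<circ> perm_of L = id"
  shows "generates_transitive d (insert s (set (map transposition_of L))) \<longleftrightarrow> connects L {1..d}"
    (is "generates_transitive d ?T \<longleftrightarrow> _")
proof
  let ?G = "generate (sym_group d) ?T"
  have tr: "transposition_of e permutes {1..d}" if "e \<in> set L" for e
    using L that by (intro permutes_swap_id) (auto simp: edges_def)
  {
    assume trans: "generates_transitive d ?T"
    show "connects L {1..d}"
      unfolding connects_def
    proof (intro allI impI)
      fix B assume B: "B \<subseteq> {1..d}" "closed_under L B"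
      have trB: "transposition_of e x \<in> B \<longleftrightarrow> x \<in> B" if "e \<in> set L" for e x
        using B(2) that by (auto simp: closed_under_def Transposition.transpose_def)
      have permB: "perm_of M x \<in> B \<longleftrightarrow> x \<in> B" if "set M \<subseteq> set L" for M x
        using that by (induction M) (auto simp: trB)
      have sB: "s x \<in> B \<longleftrightarrow> x \<in> B" for x
      proof -
        have "perm_of L (s x) = x"
          using s by (metis comp_apply id_apply permutes_inj[OF s(1)] injD)
        then show ?thesis using permB[of L "s x"] by simp
      qed
      have "p permutes {1..d} \<and> (\<forall>x. p x \<in> B \<longleftrightarrow> x \<in> B)" if "p \<in> ?G" for p
        using that
      proof induction
        case one
        show ?case unfolding sym_group_one by (intro conjI permutes_id) simp
      next
        case (incl h)
        then show ?case using s tr sB trB by auto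
      next
        case (inv h)
        then have h: "h permutes {1..d}" "\<And>x. h x \<in> B \<longleftrightarrow> x \<in> B" using s tr sB trB by auto
        have "inv\<^bsub>sym_group d\<^esub> h = inv' h"
          using h(1) by (intro sym_group_inv_equality) (simp add: sym_group_carrier)
        moreover have "inv' h x \<in> B \<longleftrightarrow> x \<in> B" for x
          using h(2)[of "inv' h x"] permutes_inverses(1)[OF h(1), of x] by simp
        ultimately show ?case using permutes_inv[OF h(1)] by simp
      next
        case (eng h1 h2)
        show ?case unfolding sym_group_mult by (intro conjI permutes_compose) (use eng in auto)
      qed
      then have GB: "p x \<in> B \<longleftrightarrow> x \<in> B" if "p \<in> ?G" for p x using that by blast
      show "B = {} \<or> B = {1..d}"
      proof (rule disjCI)
        assume "B \<noteq> {1..d}"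
        then have "B \<subset> {1..d}" using B(1) by simp
        from psubset_imp_ex_mem[OF this] obtain y where y: "y \<in> {1..d}" "y \<notin> B" by (elim exE DiffE)
        have False if xB: "x \<in> B" for x
        proof -
          have "x \<in> {1..d}" using xB B(1) by (rule rev_subsetD)
          then have "\<exists>p\<in>?G. p x = y" using trans y(1) unfolding generates_transitive_def by simp
          then obtain p where "p \<in> ?G" "p x = y" by (elim bexE)
          then show False using GB[of p x] xB y(2) by simp
        qed
        then show "B = {}" by blast
      qed
    qed
  }
  {
    assume conn: "connects L {1..d}"
    show "generates_transitive d ?T"
      unfolding generates_transitive_def
    proof (intro ballI)
      fix x y assume x: "x \<in> {1..d}" and y: "y \<in> {1..d}"
      \<comment> \<open>The orbit of x under the group; it is closed under \<open>L\<close>, hence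
        all of {1..d}.\<close>
      define B where "B = {z \<in> {1..d}. \<exists>p\<in>?G. p x = z}"
      have step: "transposition_of e z \<in> B" if e: "e \<in> set L" and z: "z \<in> B" for e z
      proof -
        obtain p where p: "p \<in> ?G" "p x = z" using z by (auto simp: B_def)
        have "transposition_of e \<in> ?G" using e by (intro generate.incl) auto
        then have "transposition_of e \<circ> p \<in> ?G"
          using generate.eng[OF _ p(1)] by (simp add: sym_group_mult)
        moreover have "transposition_of e z \<in> {1..d}"
          using permutes_in_image[OF tr[OF e], of z] z by (simp add: B_def)
        ultimately show ?thesis unfolding B_def using p(2) by (auto intro!: bexI[of _ "transposition_of e \<circ> p"])
      qed
      have "closed_under L B"
        unfolding closed_under_def
      proof (intro ballI iffI)
        fix e assume e: "e \<in> set L"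
        show "snd e \<in> B" if "fst e \<in> B" using step[OF e that] by simp
        show "fst e \<in> B" if "snd e \<in> B" using step[OF e that] by simp
      qed
      moreover have "x \<in> B"
        using x generate.one[of "sym_group d" ?T] by (auto simp: B_def sym_group_one intro!: bexI[of _ id])
      moreover have "B \<subseteq> {1..d}" by (auto simp: B_def)
      ultimately have "B = {1..d}" using conn by (auto simp: connects_def)
      then show "\<exists>p\<in>?G. p x = y" using y by (auto simp: B_def)
    qed
  }
qed

text \<open>The product being the identity means that the transpositions factor the inverse of
  \<open>s\<close>.\<close>

lemma monotone_Hurwitz_tuples_eq:
  "monotone_Hurwitz_tuples g M = (\<lambda>(s, L). (s, map transposition_of L)) `
    (SIGMA s:{s. s permutes {1..sum_mset M} \<and> cycle_mset {1..sum_mset M} s = M}.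
       factorizations {1..sum_mset M} (inv' s) (2 * g + size M + sum_mset M - 2))"
proof -
  let ?d = "sum_mset M"
  let ?r = "2 * g + size M + ?d - 2"
  have *: "(s, map transposition_of L) \<in> monotone_Hurwitz_tuples g M
      \<longleftrightarrow> cycle_mset {1..?d} s = M \<and> L \<in> factorizations {1..?d} (inv' s) ?r"
    if s: "s permutes {1..?d}" and L: "set L \<subseteq> edges {1..?d}" "sorted (map snd L)" for s L
  proof -
    have "s \<circ> perm_of L = id \<longleftrightarrow> (\<forall>x\<in>{1..?d}. perm_of L x = inv' s x)"
    proof
      assume "s \<circ> perm_of L = id"
      then have "s (perm_of L x) = x" for x by (metis comp_apply id_apply)
      then have "inv' s x = perm_of L x" for x
        by (simp only: permutes_inv_eq[OF s])
      then show "\<forall>x\<in>{1..?d}. perm_of L x = inv' s x" by simp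
    next
      assume eq: "\<forall>x\<in>{1..?d}. perm_of L x = inv' s x"
      \<comment> \<open>\<open>factorizations\<close> compares values on {1..d} only; outside, both
        permutations are the identity.\<close>
      have "perm_of L x = x" if "x \<notin> {1..?d}" for x
        using L(1)
      proof (induction L)
        case (Cons e L)
        then have "fst e \<noteq> x" "snd e \<noteq> x" using that by (auto simp: edges_def)
        then show ?case using Cons by simp
      qed simp
      then have "perm_of L x = inv' s x" for x
        using eq permutes_not_in[OF permutes_inv[OF s], of x] by (cases "x \<in> {1..?d}") auto
      then show "s \<circ> perm_of L = id"
        using permutes_inverses(1)[OF s] by (auto simp: fun_eq_iff)
    qed
    moreover have "monotone_transpositions ?d (map transposition_of L)"
      using L by (auto simp: monotone_transpositions_iff)
    ultimately show ?thesis
      using s L generates_transitive_iff_connects[OF L(1) s]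
      by (auto simp: monotone_Hurwitz_tuples_def Let_def cycle_type_eq_cycle_mset foldr_transpositions
          factorizations_def)
  qed
  show ?thesis
  proof (intro equalityI subsetI)
    fix y assume y: "y \<in> monotone_Hurwitz_tuples g M"
    obtain s ts where st: "y = (s, ts)" by (cases y)
    have s: "s permutes {1..?d}" and "monotone_transpositions ?d ts"
      using y by (auto simp: monotone_Hurwitz_tuples_def Let_def st)
    then obtain L where L: "ts = map transposition_of L" "set L \<subseteq> edges {1..?d}" "sorted (map snd L)"
      by (auto simp: monotone_transpositions_iff)
    show "y \<in> (\<lambda>(s, L). (s, map transposition_of L)) `
      (SIGMA s:{s. s permutes {1..?d} \<and> cycle_mset {1..?d} s = M}. factorizations {1..?d} (inv' s) ?r)"
      using *[OF s L(2,3)] y s L(1) by (intro image_eqI[of _ _ "(s, L)"]) (auto simp: st)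
  next
    fix y assume "y \<in> (\<lambda>(s, L). (s, map transposition_of L)) `
      (SIGMA s:{s. s permutes {1..?d} \<and> cycle_mset {1..?d} s = M}. factorizations {1..?d} (inv' s) ?r)"
    then obtain s L where y: "y = (s, map transposition_of L)" and s: "s permutes {1..?d}"
      "cycle_mset {1..?d} s = M" and L: "L \<in> factorizations {1..?d} (inv' s) ?r" by auto
    then show "y \<in> monotone_Hurwitz_tuples g M"
      using *[OF s(1), of L] by (auto simp: factorizations_def)
  qed
qed

theorem theorem0p3:
  fixes d :: nat and \<alpha> :: "nat multiset"
  assumes "d \<ge> 1" and "is_partition \<alpha> d"
  shows "real (card_Aut \<alpha>) / fact d * real (monotone_Hurwitz 0 \<alpha>) =
           real (\<Prod>a\<in>#\<alpha>. (2 * a) choose a) * rising (2 * real d + 1) (int (size \<alpha>) - 3)"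
proof -
  have d: "sum_mset \<alpha> = d" and pos: "0 \<notin># \<alpha>" using assms(2) by (simp_all add: is_partition_def)
  define X where "X = {s. s permutes {1..d} \<and> cycle_mset {1..d} s = \<alpha>}"
  define r where "r = size \<alpha> + d - 2"
  define R where "R = rising (2 * real d + 1) (int (size \<alpha>) - 3)"
  have "\<alpha> \<noteq> {#}" using d assms(1) by auto
  then have "size \<alpha> \<ge> 1" by (simp add: Suc_le_eq nonempty_has_size)
  have finX: "finite X"
    unfolding X_def using finite_permutations[of "{1..d}"] by (auto intro: finite_subset[rotated])
  have inj: "inj_on (map transposition_of) (factorizations {1..d} p r)" for p
    by (rule inj_on_subset[OF inj_on_map_transpositions[of "{1..d}"]]) (auto simp: factorizations_def)
  have "inj_on (\<lambda>(s, L). (s, map transposition_of L)) (SIGMA s:X. factorizations {1..d} (inv' s) r)"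
    by (rule inj_onI) (auto dest: inj_onD[OF inj])
  then have "monotone_Hurwitz 0 \<alpha> = card (SIGMA s:X. factorizations {1..d} (inv' s) r)"
    unfolding monotone_Hurwitz_def monotone_Hurwitz_tuples_eq d
    by (simp add: card_image X_def r_def)
  also have "\<dots> = (\<Sum>s\<in>X. card (factorizations {1..d} (inv' s) r))"
    using finX by (intro card_SigmaI) auto
  finally have "real (monotone_Hurwitz 0 \<alpha>) = (\<Sum>s\<in>X. real (card (factorizations {1..d} (inv' s) r)))"
    by simp
  also have "\<dots> = (\<Sum>s\<in>X. real (prod_mset \<alpha>) * real (\<Prod>a\<in>#\<alpha>. (2 * a) choose a) * R)"
  proof (rule sum.cong)
    fix s assume "s \<in> X"
    then have s: "s permutes {1..d}" and ct: "cycle_mset {1..d} s = \<alpha>" by (auto simp: X_def)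
    have perm: "permutation s" using s by (rule permutes_finite_imp_permutation) simp
    have inv: "inv' s permutes {1..d}" by (rule permutes_inv[OF s])
    \<comment> \<open>A permutation and its inverse have the same orbits, so the count for the
      inverse is expressed by the cycle type of \<open>s\<close>.\<close>
    have cyc: "cycles {1..d} (inv' s) = cycles {1..d} s"
      unfolding cycles_def by (simp add: orbit_inv_eq[OF perm])
    have card: "card (cycles {1..d} s) = size \<alpha>"
      unfolding ct[symmetric] cycle_mset_def by simp
    have "card (cycles {1..d} (inv' s)) + card {1..d} = r + 2"
      unfolding cyc card using \<open>size \<alpha> \<ge> 1\<close> assms(1) by (simp add: r_def)
    then have "real (card (factorizations {1..d} (inv' s) r)) = planar_count {1..d} (inv' s)"
      using assms(1)
      by (intro card_factorizations_planar permutes_finite_imp_permutation[OF inv] permutes_imp_invariant[OF inv])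
        simp_all
    also have "\<dots> = (\<Prod>C\<in>cycles {1..d} s. real (card C) * central_binomial (card C)) * R"
      unfolding planar_count_def cyc card R_def by simp
    also have "(\<Prod>C\<in>cycles {1..d} s. real (card C) * central_binomial (card C))
        = (\<Prod>a\<in>#\<alpha>. real a * central_binomial a)"
      unfolding ct[symmetric] cycle_mset_def prod_unfold_prod_mset by (simp add: image_mset.compositionality comp_def)
    also have "\<dots> = real (prod_mset \<alpha>) * real (\<Prod>a\<in>#\<alpha>. (2 * a) choose a)"
      by (induction \<alpha>) (simp_all add: central_binomial_def)
    finally show "real (card (factorizations {1..d} (inv' s) r))
        = real (prod_mset \<alpha>) * real (\<Prod>a\<in>#\<alpha>. (2 * a) choose a) * R" .
  qed simp
  finally have H: "real (monotone_Hurwitz 0 \<alpha>)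
      = real (card X) * real (prod_mset \<alpha>) * real (\<Prod>a\<in>#\<alpha>. (2 * a) choose a) * R" by simp
  have "card X * (card_Aut \<alpha> * prod_mset \<alpha>) = fact (card {1..d})"
    unfolding X_def using pos d by (intro card_permutes_cycle_mset) auto
  then have "real (card X) * (real (card_Aut \<alpha>) * real (prod_mset \<alpha>)) = fact d"
    by (simp flip: of_nat_mult)
  then have "real (card_Aut \<alpha>) / fact d * (real (card X) * real (prod_mset \<alpha>)) = 1"
    by (simp add: field_simps)
  then have "real (card_Aut \<alpha>) / fact d * real (monotone_Hurwitz 0 \<alpha>)
      = 1 * (real (\<Prod>a\<in>#\<alpha>. (2 * a) choose a) * R)"
    unfolding H by (simp only: mult.assoc[symmetric])
  then show ?thesis by (simp add: R_def)
qed

end
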